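(* The first return map $\Phi$ is equivalent to the double cover $\widetilde T$ of the natural extension of the spliced continued fraction map: the bijection $J\circ\varphi:\pi(X)\to\Omega^\pm$ maps $\pi(X^* )$ onto $(\Omega^\pm)^*$, and $$(J\circ\varphi)\circ\Phi=\widetilde T\circ(J\circ\varphi)\quad\text{on }\pi(X^* ).$$
   Context: Geometric side. $\Theta\subset\mathrm{SL}(2,\mathbb Z)$ is the theta group: matrices congruent mod $2$ to $\begin{pmatrix}1&0\\0&1\end{pmatrix}$ or $\begin{pmatrix}0&-1\\1&0\end{pmatrix}$, acting on the upper half plane $\mathbb H^2$. $\mathcal M=\Theta\backslash\mathbb H^2$, and $\pi$ also denotes $T^1\mathbb H^2\to T^1\mathcal M$. For an oriented geodesic $\gamma$ in $\mathbb H^2$, $\gamma_\infty,\gamma_{-\infty}$ are its forward and backward endpoints; for $v\in T^1\mathbb H^2$, $\gamma^v$ is the geodesic determined by $v$ and $p(v)$ its base point. Let $\mathcal I_+=(1,\infty)\times[-\sqrt3,-\sqrt3+2)$, $\mathcal I_-=(-\infty,-1)\times(\sqrt3-2,\sqrt3]$, $X=X_+\cup X_-$ with $X_\pm=\{v\in T^1\mathbb H^2:\mathrm{Re}(p(v))=\pm1,\ (\gamma^v_\infty,\gamma^v_{-\infty})\in\mathcal I_\pm\}$, and let $A_\pm$ be the set of geodesics $\gamma$ with $(\gamma_\infty,\gamma_{-\infty})\in\mathcal I_\pm$, $A=A_+\cup A_-$. Let $E=\{\frac{k}{k-1},\frac{2k+1}{2k-1},k:k\ge2\}$ and $X^*=\{v\in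 X:|\gamma^v_\infty|\notin E\}$. The map $\varphi:\pi(X)\to A$, $\pi(v)\mapsto\gamma^v$ ($v\in X$), is a bijection. $\Phi$ is the first return map to $\pi(X)$ of the geodesic flow $g_t$ on $T^1\mathcal M$: $\Phi(u)=g_t(u)$ for the smallest $t>0$ with $g_t(u)\in\pi(X)$; it is defined on $\pi(X^* )$. Symbolic side. Let $\mathscr A=\{(k,\varepsilon)_s:k\ge2,\ \varepsilon=\pm1,\ s\in\{e,o\}\}\cup\{(1,1)_e\}$, with intervals $I_{(1,+1)_e}=[\frac13,\frac12]$ and, for $k\ge2$, $I_{(k,+1)_e}=[\frac1{2k+1},\frac1{2k})$, $I_{(k,-1)_e}=[\frac1{2k},\frac1{2k-1})$, $I_{(k,-1)_o}=(\frac{k-1}k,\frac{2k-1}{2k+1}]$, $I_{(k,+1)_o}=(\frac{2k-1}{2k+1},\frac k{k+1}]$ partitioning $(0,1)$. The spliced continued fraction map $T$ is $\frac1x-2k$ on $I_{(k,+1)_e}$ ($k\ge 1$), $2k-\frac1x$ on $I_{(k,-1)_e}$, $\frac{kx-(k-1)}{k-(k+1)x}$ on $I_{(k,-1)_o}$, $\frac{k-(k+1)x}{kx-(k-1)}$ on $I_{(k,+1)_o}$. For $(b,\eta)_s\in\mathscr A$ put $\bar h_{(b,\eta)_e}(y)=\frac{\eta}{2b+y}$ and $\bar h_{(b,\eta)_o}(y)=\dfrac1{1+\frac{\eta}{(b-\overline\eta)+\frac1{1+y}}}$ with $\overline\eta=\max(0,\eta)$. Let $\overline T(x,y)=(T(x),\bar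 h_{(a_1,\varepsilon_1)_{s_1}}(y))$ if $x\in I_{(a_1,\varepsilon_1)_{s_1}}$. Let $\Omega^\pm=(0,1)\times(\sqrt3-2,\sqrt3]\times\{\pm1\}$, $(\Omega^\pm)^*=\{(x,y,j)\in\Omega^\pm: x\notin\partial I_{(k,\varepsilon)_s}\text{ for every }(k,\varepsilon)_s\in\mathscr A\}$, and $\widetilde T(x,y,j)=(\overline T(x,y),-\varepsilon_1 j)$, where $(a_1,\varepsilon_1)_{s_1}$ is the symbol with $x\in I_{(a_1,\varepsilon_1)_{s_1}}$; it is considered as a map $(\Omega^\pm)^*\to\Omega^\pm$. The bijection $J:A\to\Omega^\pm$ is $J(\gamma)=(\frac1{\gamma_\infty},-\gamma_{-\infty},1)$ for $\gamma\in A_+$ and $J(\gamma)=(-\frac1{\gamma_\infty},\gamma_{-\infty},-1)$ for $\gamma\in A_-$. *)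

theory Defs
  imports "HOL-Analysis.Analysis"
begin

section \<open>Unit tangent vectors, the geodesic flow and geodesics of the upper half plane\<close>

definition SL2R :: "(real^2^2) set" where
  "SL2R = {M. det M = 1}"

definition mob :: "real^2^2 \<Rightarrow> complex \<Rightarrow> complex" where
  "mob M = moebius (of_real (M$1$1)) (of_real (M$1$2)) (of_real (M$2$1)) (of_real (M$2$2))"

text \<open>A tangent vector of the upper half plane is a pair (base point, direction). The metric is
  \<open>|dz| / Im z\<close>, so a unit vector at \<open>z\<close> has Euclidean length \<open>Im z\<close>.\<close>

type_synonym tvec = "complex \<times> complex"

definition T1H :: "tvec set" where
  "T1H = {(z, w). Im z > 0 \<and> cmod w = Im z}"

definition tangent_act :: "real^2^2 \<Rightarrow> tvec \<Rightarrow> tvec" where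
  "tangent_act M v = (mob M (fst v), deriv (mob M) (fst v) * snd v)"

text \<open>The unit-speed geodesics are the curves \<open>t \<mapsto> M (\<i> e\<^sup>t)\<close> with \<open>M\<close> in \<open>SL2R\<close>. Their lifts to
  the unit tangent bundle are the flow lines of the geodesic flow. Every \<open>v\<close> in \<open>T1H\<close> lies at time
  0 on exactly one of them (the matrix \<open>M\<close> is unique up to sign).\<close>

definition geodesic_flow :: "real \<Rightarrow> tvec \<Rightarrow> tvec" where
  "geodesic_flow t v = (THE u. \<exists>M\<in>SL2R. v = tangent_act M (\<i>, \<i>) \<and>
     u = tangent_act M (of_real (exp t) * \<i>, of_real (exp t) * \<i>))"

text \<open>An oriented geodesic is represented by its flow line in the unit tangent bundle.\<close>

type_synonym geodesic = "tvec set"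

definition geodesic_of :: "tvec \<Rightarrow> geodesic" where
  "geodesic_of v = range (\<lambda>t. geodesic_flow t v)"

definition geodesics :: "geodesic set" where
  "geodesics = geodesic_of ` T1H"

text \<open>Finite endpoints on the real line. A geodesic that runs into (or comes from) the boundary
  point \<open>\<infinity>\<close> has no forward (or backward) endpoint in this sense, so that membership
  in the sets below must assert the existence of the endpoints.\<close>

definition has_forward_end :: "geodesic \<Rightarrow> real \<Rightarrow> bool" where
  "has_forward_end \<gamma> a \<longleftrightarrow>
     (\<exists>v\<in>\<gamma>. ((\<lambda>t. fst (geodesic_flow t v)) \<longlongrightarrow> complex_of_real a) at_top)"

definition has_backward_end :: "geodesic \<Rightarrow> real \<Rightarrow> bool" where
  "has_backward_end \<gamma> b \<longleftrightarrow>
     (\<exists>v\<in>\<gamma>. ((\<lambda>t. fst (geodesic_flow t v)) \<longlongrightarrow> complex_of_real b) at_bot)"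

definition forward_end :: "geodesic \<Rightarrow> real" where
  "forward_end \<gamma> = (THE a. has_forward_end \<gamma> a)"

definition backward_end :: "geodesic \<Rightarrow> real" where
  "backward_end \<gamma> = (THE b. has_backward_end \<gamma> b)"

definition ends_in :: "geodesic \<Rightarrow> (real \<times> real) set \<Rightarrow> bool" where
  "ends_in \<gamma> S \<longleftrightarrow> (\<exists>a b. has_forward_end \<gamma> a \<and> has_backward_end \<gamma> b \<and> (a, b) \<in> S)"


section \<open>The theta group and the unit tangent bundle of the quotient\<close>

definition congruent_mod2 :: "int^2^2 \<Rightarrow> int^2^2 \<Rightarrow> bool" where
  "congruent_mod2 A B \<longleftrightarrow> (\<forall>i j. A$i$j mod 2 = B$i$j mod 2)"

definition Theta :: "(int^2^2) set" where
  "Theta = {A. det A = 1 \<and>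
     (congruent_mod2 A (mat 1) \<or> congruent_mod2 A (vector [vector [0, -1], vector [1, 0]]))}"

text \<open>A point of the unit tangent bundle of \<open>\<M>\<close> is the Theta-orbit of a unit tangent vector of the
  upper half plane. The geodesic flow commutes with the action of \<open>SL2R\<close>, so it carries orbits to
  orbits.\<close>

definition proj :: "tvec \<Rightarrow> tvec set" where
  "proj v = (\<lambda>A. tangent_act (map_matrix real_of_int A) v) ` Theta"

definition quotient_flow :: "real \<Rightarrow> tvec set \<Rightarrow> tvec set" where
  "quotient_flow t u = geodesic_flow t ` u"


section \<open>The cross section and its first return map\<close>

definition I_plus :: "(real \<times> real) set" where
  "I_plus = {1<..} \<times> {- sqrt 3..<- sqrt 3 + 2}"

definition I_minus :: "(real \<times> real) set" where
  "I_minus = {..<-1} \<times> {sqrt 3 - 2<..sqrt 3}"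

definition X_plus :: "tvec set" where
  "X_plus = {v \<in> T1H. Re (fst v) = 1 \<and> ends_in (geodesic_of v) I_plus}"

definition X_minus :: "tvec set" where
  "X_minus = {v \<in> T1H. Re (fst v) = -1 \<and> ends_in (geodesic_of v) I_minus}"

definition X :: "tvec set" where
  "X = X_plus \<union> X_minus"

definition A_plus :: "geodesic set" where
  "A_plus = {\<gamma> \<in> geodesics. ends_in \<gamma> I_plus}"

definition A_minus :: "geodesic set" where
  "A_minus = {\<gamma> \<in> geodesics. ends_in \<gamma> I_minus}"

definition exceptional :: "real set" where
  "exceptional = (\<Union>k\<in>{2::nat..}.
     {real k / (real k - 1), (2 * real k + 1) / (2 * real k - 1), real k})"

definition X_star :: "tvec set" where
  "X_star = {v \<in> X. \<bar>forward_end (geodesic_of v)\<bar> \<notin> exceptional}"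

definition phi :: "tvec set \<Rightarrow> geodesic" where
  "phi u = (THE \<gamma>. \<exists>v\<in>X. u = proj v \<and> \<gamma> = geodesic_of v)"

definition is_first_return_time :: "(real \<Rightarrow> 'a \<Rightarrow> 'a) \<Rightarrow> 'a set \<Rightarrow> 'a \<Rightarrow> real \<Rightarrow> bool" where
  "is_first_return_time g S u t \<longleftrightarrow>
     0 < t \<and> g t u \<in> S \<and> (\<forall>s. 0 < s \<and> s < t \<longrightarrow> g s u \<notin> S)"

definition first_return_map :: "(real \<Rightarrow> 'a \<Rightarrow> 'a) \<Rightarrow> 'a set \<Rightarrow> 'a \<Rightarrow> 'a" where
  "first_return_map g S u = g (THE t. is_first_return_time g S u t) u"

definition Phi :: "tvec set \<Rightarrow> tvec set" where
  "Phi = first_return_map quotient_flow (proj ` X)"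


section \<open>The spliced continued fraction map and the double cover of its natural extension\<close>

datatype side = Ev | Od

text \<open>The triple \<open>(k, \<epsilon>, s)\<close> stands for the symbol \<open>(k,\<epsilon>)\<^sub>s\<close>, with \<open>Ev\<close>, \<open>Od\<close> for \<open>s = e, o\<close>.\<close>

type_synonym symbol = "nat \<times> int \<times> side"

definition alphabet :: "symbol set" where
  "alphabet = {2..} \<times> {1, -1} \<times> {Ev, Od} \<union> {(1, 1, Ev)}"

fun cell :: "symbol \<Rightarrow> real set" where
  "cell (k, \<epsilon>, Ev) =
     (if \<epsilon> = 1 then (if k = 1 then {1/3..1/2} else {1 / (2 * real k + 1)..<1 / (2 * real k)})
      else {1 / (2 * real k)..<1 / (2 * real k - 1)})"
| "cell (k, \<epsilon>, Od) =
     (if \<epsilon> = 1 then {(2 * real k - 1) / (2 * real k + 1)<..real k / (real k + 1)}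
      else {(real k - 1) / real k<..(2 * real k - 1) / (2 * real k + 1)})"

fun branch :: "symbol \<Rightarrow> real \<Rightarrow> real" where
  "branch (k, \<epsilon>, Ev) x = (if \<epsilon> = 1 then 1 / x - 2 * real k else 2 * real k - 1 / x)"
| "branch (k, \<epsilon>, Od) x =
     (if \<epsilon> = 1 then (real k - (real k + 1) * x) / (real k * x - (real k - 1))
      else (real k * x - (real k - 1)) / (real k - (real k + 1) * x))"

fun hbar :: "symbol \<Rightarrow> real \<Rightarrow> real" where
  "hbar (b, \<eta>, Ev) y = of_int \<eta> / (2 * real b + y)"
| "hbar (b, \<eta>, Od) y =
     1 / (1 + of_int \<eta> / ((real b - of_int (max 0 \<eta>)) + 1 / (1 + y)))"

text \<open>The cells of the alphabet partition the open interval (0,1).\<close>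

definition first_symbol :: "real \<Rightarrow> symbol" where
  "first_symbol x = (THE \<sigma>. \<sigma> \<in> alphabet \<and> x \<in> cell \<sigma>)"

definition spliced_map :: "real \<Rightarrow> real" where
  "spliced_map x = branch (first_symbol x) x"

definition natural_extension :: "real \<times> real \<Rightarrow> real \<times> real" where
  "natural_extension = (\<lambda>(x, y). (spliced_map x, hbar (first_symbol x) y))"

definition Omega :: "(real \<times> real \<times> int) set" where
  "Omega = {0<..<1} \<times> {sqrt 3 - 2<..sqrt 3} \<times> {1, -1}"

definition Omega_star :: "(real \<times> real \<times> int) set" where
  "Omega_star = {(x, y, j) \<in> Omega. \<forall>\<sigma>\<in>alphabet. x \<notin> frontier (cell \<sigma>)}"

definition double_cover :: "real \<times> real \<times> int \<Rightarrow> real \<times> real \<times> int" where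
  "double_cover = (\<lambda>(x, y, j). case (natural_extension (x, y), first_symbol x) of
     ((x', y'), (k, \<epsilon>, s)) \<Rightarrow> (x', y', - \<epsilon> * j))"

text \<open>On \<open>A_plus \<union> A_minus\<close>; the two sets are disjoint.\<close>

definition J :: "geodesic \<Rightarrow> real \<times> real \<times> int" where
  "J \<gamma> = (if \<gamma> \<in> A_plus then (1 / forward_end \<gamma>, - backward_end \<gamma>, 1)
          else (- 1 / forward_end \<gamma>, backward_end \<gamma>, -1))"

end

(*
  A vector of the cross section is determined by a sign j and the endpoints j a, j b (a > 1 > b) of
  its geodesic. The lines over the odd integers and their Theta-translates tessellate the half plane
  into ideal quadrilaterals. A geodesic that enters the quadrilateral with vertices 1, 2, 3, infinity
  through the line over 1 leaves it through the side (3, infinity), (2, 3) or (1, 2) according to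
  a > 3, 2 < a < 3 or 1 < a < 2, and an element of Theta carries that side back to a line over 1 or -1:
    (a, b, j) -> (a - 2, b - 2, j), (1/(a - 2), 1/(b - 2), -j) or (1/(2 - a), 1/(2 - b), j).
  No point strictly between two consecutive crossings has a Theta-translate over 1 or -1, and a
  crossing lies in the section iff b is in [-sqrt 3, 2 - sqrt 3). So the first return is an iteration
  of these three moves: translations followed by an inversion give the even branches of the spliced
  map, repetitions of the last move followed by one of the others give the odd branches.
*)
theory Submission
  imports Defs
begin

text \<open>The images of the line over an odd integer under SL(2, Z) are edges of the Farey
  tessellation, and two such edges never cross. The quadrilateral with vertices -1, 0, 1, infinity
  consists of two Farey triangles glued along the line over 0, so that line is the only edge that
  could hide a return inside it. \<open>Theta\<close> excludes it: an odd line joins the cusp class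
  of 1 to that of infinity, whereas 0 and infinity lie in the same class. In the proof the edges
  appear as quadratic forms of discriminant 1 and the cusp classes as parities. The constant sqrt 3
  comes from the backward endpoint. Translation moves [-sqrt 3, 2 - sqrt 3) to the left by its full
  length 2, and b -> 1/(2 - b) moves it to the right, since -sqrt 3 goes to 1/(2 + sqrt 3) = 2 -
  sqrt 3. Once b is left of the section, only an inversion brings it back; once b is right of it, a
  further 1/(2 - b) stays outside and each of the other two moves returns. So a run of translations
  and a run of the last move never mix within one return.\<close>

section \<open>Frames and the geodesic flow\<close>

text \<open>The image of the vector \<open>(\<i>, \<i>)\<close> under the matrix \<open>((p, q), (r, s))\<close>, normalised so that it depends
  only on the matrix up to a nonzero scalar.\<close>

definition frame :: "real \<Rightarrow> real \<Rightarrow> real \<Rightarrow> real \<Rightarrow> tvec" where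
  "frame p q r s =
     (Complex q p / Complex s r, \<i> * of_real (p * s - q * r) / (Complex s r)\<^sup>2)"

lemma Complex_nonzero_of_det:
  fixes p q r s :: real
  assumes "p * s - q * r > 0"
  shows "Complex s r \<noteq> 0"
  using assms by (auto simp: complex_eq_iff)

text \<open>Both components are homogeneous of degree 0 in the matrix. Hence an arc need not be
  normalised to determinant 1, which would bring square roots of \<open>a - b\<close> into its
  entries; only positivity of the determinant is carried along.\<close>

lemma frame_scale:
  assumes "l \<noteq> 0"
  shows "frame (l * p) (l * q) (l * r) (l * s) = frame p q r s"
proof -
  have e: "Complex (l * x) (l * y) = of_real l * Complex x y" for x y
    by (simp add: complex_eq_iff)
  have "l * p * (l * s) - l * q * (l * r) = l\<^sup>2 * (p * s - q * r)"
    by (simp add: power2_eq_square algebra_simps)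
  then show ?thesis
    using assms unfolding frame_def e by (simp add: power_mult_distrib)
qed

lemma frame_Im_pos:
  assumes "p * s - q * r > 0"
  shows "Im (fst (frame p q r s)) > 0"
proof -
  have "s\<^sup>2 + r\<^sup>2 > 0"
    using Complex_nonzero_of_det[OF assms] by (auto simp: complex_eq_iff sum_power2_gt_zero_iff)
  then show ?thesis using assms by (simp add: frame_def Im_divide algebra_simps)
qed

lemma frame_in_T1H:
  assumes "p * s - q * r > 0"
  shows "frame p q r s \<in> T1H"
proof -
  have "s\<^sup>2 + r\<^sup>2 > 0"
    using Complex_nonzero_of_det[OF assms] by (auto simp: complex_eq_iff sum_power2_gt_zero_iff)
  moreover have "(cmod (Complex s r))\<^sup>2 = s\<^sup>2 + r\<^sup>2" by (simp add: cmod_power2)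
  ultimately have "cmod (snd (frame p q r s)) = Im (fst (frame p q r s))"
    using assms
    by (simp add: frame_def norm_divide norm_mult norm_power Im_divide algebra_simps del: of_real_diff of_real_mult)
  then show ?thesis
    using frame_Im_pos[OF assms] unfolding T1H_def by (auto simp: case_prod_unfold)
qed

lemma T1H_frame:
  assumes "v \<in> T1H"
  obtains p q r s where "p * s - q * r = 1" "v = frame p q r s"
proof -
  obtain z w where v: "v = (z, w)" by (cases v)
  have z: "Im z > 0" and w: "cmod w = Im z" using assms v by (auto simp: T1H_def)
  \<comment> \<open>If \<open>v\<close> is the frame of a matrix of determinant 1, then
    \<open>w\<close> is the imaginary unit divided by the square of the denominator. So the
    denominator must be a square root \<open>c\<close> of \<open>\<i> / w\<close>, and the numerator
    is \<open>z * c\<close>.\<close>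
  define c where "c = csqrt (\<i> / w)"
  have w0: "w \<noteq> 0" using z w by auto
  have c2: "c\<^sup>2 = \<i> / w" by (simp add: c_def)
  have c0: "c \<noteq> 0" using w0 by (simp add: c_def)
  have "(cmod c)\<^sup>2 = 1 / Im z" by (metis c2 norm_power norm_divide norm_ii w)
  then have nc: "(Re c)\<^sup>2 + (Im c)\<^sup>2 = 1 / Im z" by (simp add: cmod_power2)
  have "Im (z * c) * Re c - Re (z * c) * Im c = Im z * ((Re c)\<^sup>2 + (Im c)\<^sup>2)"
    by (simp add: algebra_simps power2_eq_square)
  also have "\<dots> = 1" using nc z by simp
  finally have d: "Im (z * c) * Re c - Re (z * c) * Im c = 1" .
  have "v = frame (Im (z * c)) (Re (z * c)) (Im c) (Re c)"
    unfolding frame_def d complex_surj using c0 w0 by (simp add: v c2)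
  with d show ?thesis by (rule that)
qed

text \<open>On frames the group acts by left multiplication of matrices, while the flow
  (\<open>geodesic_flow_frame\<close>) is right multiplication by diag(e^t, 1), a multiple of
  diag(e^(t/2), e^(-t/2)). The two commute, which is the source of all equivariance below.\<close>

lemma tangent_act_frame:
  assumes "det M = 1" "p * s - q * r > 0"
  shows "tangent_act M (frame p q r s) =
    frame (M$1$1 * p + M$1$2 * r) (M$1$1 * q + M$1$2 * s)
          (M$2$1 * p + M$2$2 * r) (M$2$1 * q + M$2$2 * s)"
proof -
  let ?a = "M$1$1" and ?b = "M$1$2" and ?c = "M$2$1" and ?d = "M$2$2"
  have det: "?a * ?d - ?b * ?c = 1" using assms(1) by (simp add: det_2)
  let ?n = "Complex s r" and ?m = "Complex q p"
  let ?z = "?m / ?n"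
  have n0: "?n \<noteq> 0" using Complex_nonzero_of_det[OF assms(2)] .
  have num: "of_real ?a * ?m + of_real ?b * ?n = Complex (?a * q + ?b * s) (?a * p + ?b * r)"
    by (simp add: complex_eq_iff)
  have den: "of_real ?c * ?m + of_real ?d * ?n = Complex (?c * q + ?d * s) (?c * p + ?d * r)"
    by (simp add: complex_eq_iff)
  have det': "(?a * p + ?b * r) * (?c * q + ?d * s) - (?a * q + ?b * s) * (?c * p + ?d * r)
      = (?a * ?d - ?b * ?c) * (p * s - q * r)"
    by (simp add: algebra_simps)
  then have det2: "(?a * p + ?b * r) * (?c * q + ?d * s) - (?a * q + ?b * s) * (?c * p + ?d * r)
      = p * s - q * r"
    using det by simp
  have den0: "of_real ?c * ?m + of_real ?d * ?n \<noteq> 0"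
    unfolding den using Complex_nonzero_of_det det2 assms(2) by metis
  have den1: "of_real ?c * ?z + of_real ?d = (of_real ?c * ?m + of_real ?d * ?n) / ?n"
    using n0 by (simp add: field_simps)
  have num1: "of_real ?a * ?z + of_real ?b = (of_real ?a * ?m + of_real ?b * ?n) / ?n"
    using n0 by (simp add: field_simps)
  have den10: "of_real ?c * ?z + of_real ?d \<noteq> 0" unfolding den1 using den0 n0 by simp
  have detc: "of_real ?a * of_real ?d - of_real ?b * of_real ?c = (1 :: complex)"
    by (metis det of_real_1 of_real_diff of_real_mult)
  have "(mob M has_field_derivative
      (of_real ?a * (of_real ?c * ?z + of_real ?d) - (of_real ?a * ?z + of_real ?b) * of_real ?c)
        / ((of_real ?c * ?z + of_real ?d) * (of_real ?c * ?z + of_real ?d))) (at ?z)"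
    unfolding mob_def moebius_def
    using den10 by (auto intro!: derivative_eq_intros)
  moreover have "of_real ?a * (of_real ?c * ?z + of_real ?d) - (of_real ?a * ?z + of_real ?b) * of_real ?c
     = of_real ?a * of_real ?d - of_real ?b * of_real ?c" by (simp add: algebra_simps)
  ultimately have deriv: "deriv (mob M) ?z = 1 / (of_real ?c * ?z + of_real ?d)\<^sup>2"
    using detc by (metis DERIV_imp_deriv power2_eq_square)
  have f: "mob M ?z = (of_real ?a * ?m + of_real ?b * ?n) / (of_real ?c * ?m + of_real ?d * ?n)"
    unfolding mob_def moebius_def num1 den1 using n0 den0 by simp
  have "deriv (mob M) ?z * (\<i> * of_real (p * s - q * r) / ?n\<^sup>2)
      = \<i> * of_real (p * s - q * r) / (of_real ?c * ?m + of_real ?d * ?n)\<^sup>2"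
    unfolding deriv den1 using n0 den0 by (simp add: power_divide)
  with f show ?thesis
    unfolding tangent_act_def frame_def fst_conv snd_conv det2 num den by simp
qed

text \<open>Equal directions make the denominators agree up to sign, and equal base points then do
  the same for the numerators. This sign is the only ambiguity in the matrix that defines the
  flow.\<close>

lemma frame_eq_imp:
  assumes "p * s - q * r = 1" "p' * s' - q' * r' = 1" "frame p q r s = frame p' q' r' s'"
  shows "(p', q', r', s') = (p, q, r, s) \<or> (p', q', r', s') = (-p, -q, -r, -s)"
proof -
  have n: "Complex s r \<noteq> 0" "Complex s' r' \<noteq> 0"
    using Complex_nonzero_of_det assms(1,2) by (metis zero_less_one)+
  have "\<i> / (Complex s r)\<^sup>2 = \<i> / (Complex s' r')\<^sup>2"
    and z: "Complex q p / Complex s r = Complex q' p' / Complex s' r'"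
    using assms unfolding frame_def by (auto simp del: of_real_diff of_real_mult)
  then have "(Complex s r)\<^sup>2 = (Complex s' r')\<^sup>2" using n by (simp add: field_simps)
  then consider "Complex s' r' = Complex s r" | "Complex s' r' = - Complex s r"
    by (metis power2_eq_iff)
  then show ?thesis
  proof cases
    case 1
    then have "Complex q' p' = Complex q p" using z n by (simp add: field_simps)
    with 1 show ?thesis by simp
  next
    case 2
    then have "Complex q' p' = - Complex q p" using z n by (simp add: field_simps)
    with 2 show ?thesis by (simp add: complex_eq_iff)
  qed
qed

lemma exp_ii_frame: "(of_real (exp t) * \<i>, of_real (exp t) * \<i>) = frame (exp t) 0 0 1"
  by (simp add: frame_def complex_eq_iff Re_divide Im_divide power2_eq_square)

lemma ii_frame: "(\<i>, \<i>) = frame 1 0 0 1"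
  using exp_ii_frame[of 0] by simp

lemma geodesic_flow_frame:
  assumes "p * s - q * r > 0"
  shows "geodesic_flow t (frame p q r s) = frame (exp t * p) q (exp t * r) s"
proof -
  define l where "l = 1 / sqrt (p * s - q * r)"
  have l0: "l \<noteq> 0" using assms by (simp add: l_def)
  have l2: "l * l * (p * s - q * r) = 1"
    using assms by (simp add: l_def del: real_sqrt_mult flip: real_sqrt_mult)
  define M :: "real^2^2" where "M = vector [vector [l * p, l * q], vector [l * r, l * s]]"
  have M: "M$1$1 = l * p" "M$1$2 = l * q" "M$2$1 = l * r" "M$2$2 = l * s"
    by (simp_all add: M_def)
  have dM: "det M = 1" using l2 by (simp add: det_2 M algebra_simps)
  have key: "\<exists>M\<in>SL2R. frame p q r s = tangent_act M (\<i>, \<i>) \<and>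
     frame (exp t * p) q (exp t * r) s
       = tangent_act M (of_real (exp t) * \<i>, of_real (exp t) * \<i>)"
  proof (intro bexI conjI)
    show "M \<in> SL2R" using dM by (simp add: SL2R_def)
    show "frame p q r s = tangent_act M (\<i>, \<i>)"
      unfolding ii_frame using dM frame_scale[OF l0, of p q r s]
      by (simp add: tangent_act_frame M)
    show "frame (exp t * p) q (exp t * r) s
       = tangent_act M (of_real (exp t) * \<i>, of_real (exp t) * \<i>)"
      unfolding exp_ii_frame using dM frame_scale[OF l0, of "exp t * p" q "exp t * r" s]
      by (simp add: tangent_act_frame M mult_ac)
  qed
  show ?thesis unfolding geodesic_flow_def
  proof (rule the_equality, rule key)
    fix u
    assume "\<exists>M\<in>SL2R. frame p q r s = tangent_act M (\<i>, \<i>) \<and>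
       u = tangent_act M (of_real (exp t) * \<i>, of_real (exp t) * \<i>)"
    then obtain N where N: "det N = 1" "frame p q r s = tangent_act N (\<i>, \<i>)"
        "u = tangent_act N (of_real (exp t) * \<i>, of_real (exp t) * \<i>)"
      by (auto simp: SL2R_def)
    have dN: "N$1$1 * N$2$2 - N$1$2 * N$2$1 = 1" using N(1) by (simp add: det_2)
    have "frame p q r s = frame (N$1$1) (N$1$2) (N$2$1) (N$2$2)"
      using N unfolding ii_frame by (simp add: tangent_act_frame)
    moreover have u: "u = frame (N$1$1 * exp t) (N$1$2) (N$2$1 * exp t) (N$2$2)"
      using N unfolding exp_ii_frame by (simp add: tangent_act_frame)
    moreover have "(l * p) * (l * s) - (l * q) * (l * r) = 1"
      using l2 by (simp add: algebra_simps)
    ultimately consider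
        "(N$1$1, N$1$2, N$2$1, N$2$2) = (l * p, l * q, l * r, l * s)"
      | "(N$1$1, N$1$2, N$2$1, N$2$2) = (-(l * p), -(l * q), -(l * r), -(l * s))"
      using frame_eq_imp[OF _ dN] frame_scale[OF l0, of p q r s] by metis
    then show "u = frame (exp t * p) q (exp t * r) s"
    proof cases
      case 1
      then show ?thesis
        using u frame_scale[OF l0, of "exp t * p" q "exp t * r" s] by (simp add: mult_ac)
    next
      case 2
      then show ?thesis
        using u l0 frame_scale[of "-l" "exp t * p" q "exp t * r" s] by (simp add: mult_ac)
    qed
  qed
qed

section \<open>The theta group\<close>

lemma frame_flow_det:
  fixes p q r s t :: real
  assumes "p * s - q * r > 0"
  shows "exp t * p * s - q * (exp t * r) > 0"
proof -
  have "exp t * p * s - q * (exp t * r) = exp t * (p * s - q * r)" by (simp add: algebra_simps)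
  then show ?thesis using assms by simp
qed

lemma geodesic_flow_T1H:
  assumes "v \<in> T1H"
  shows "geodesic_flow t v \<in> T1H"
proof -
  obtain p q r s where 1: "p * s - q * r = 1" and v: "v = frame p q r s"
    using T1H_frame[OF assms] .
  have "exp t * p * s - q * (exp t * r) > 0" using 1 by (intro frame_flow_det) simp
  then show ?thesis using frame_in_T1H 1 by (simp add: v geodesic_flow_frame)
qed

lemma geodesic_flow_add:
  assumes "v \<in> T1H"
  shows "geodesic_flow s (geodesic_flow t v) = geodesic_flow (s + t) v"
proof -
  obtain p q r s' where 1: "p * s' - q * r = 1" and v: "v = frame p q r s'"
    using T1H_frame[OF assms] .
  have "exp t * p * s' - q * (exp t * r) > 0" using 1 by (intro frame_flow_det) simp
  then show ?thesis using 1 by (simp add: v geodesic_flow_frame exp_add mult_ac)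
qed

lemma tangent_act_T1H:
  assumes "v \<in> T1H" "det M = 1"
  shows "tangent_act M v \<in> T1H"
    and "geodesic_flow t (tangent_act M v) = tangent_act M (geodesic_flow t v)"
proof -
  obtain p q r s where 1: "p * s - q * r = 1" and v: "v = frame p q r s"
    using T1H_frame[OF assms(1)] .
  have 2: "exp t * p * s - q * (exp t * r) > 0" using 1 by (intro frame_flow_det) simp
  have "(M$1$1 * p + M$1$2 * r) * (M$2$1 * q + M$2$2 * s)
      - (M$1$1 * q + M$1$2 * s) * (M$2$1 * p + M$2$2 * r) = det M * (p * s - q * r)"
    by (simp add: det_2 algebra_simps)
  then have 3: "(M$1$1 * p + M$1$2 * r) * (M$2$1 * q + M$2$2 * s)
      - (M$1$1 * q + M$1$2 * s) * (M$2$1 * p + M$2$2 * r) > 0"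
    using 1 assms by simp
  show "tangent_act M v \<in> T1H"
    using 1 3 assms by (simp add: v tangent_act_frame frame_in_T1H)
  show "geodesic_flow t (tangent_act M v) = tangent_act M (geodesic_flow t v)"
    using 1 2 3 assms by (simp add: v tangent_act_frame geodesic_flow_frame algebra_simps)
qed

lemma tangent_act_mult:
  assumes "v \<in> T1H" "det M = 1" "det N = 1"
  shows "tangent_act (M ** N) v = tangent_act M (tangent_act N v)"
proof -
  obtain p q r s where 1: "p * s - q * r = 1" and v: "v = frame p q r s"
    using T1H_frame[OF assms(1)] .
  have "(N$1$1 * p + N$1$2 * r) * (N$2$1 * q + N$2$2 * s)
      - (N$1$1 * q + N$1$2 * s) * (N$2$1 * p + N$2$2 * r) = det N * (p * s - q * r)"
    by (simp add: det_2 algebra_simps)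
  then have 3: "(N$1$1 * p + N$1$2 * r) * (N$2$1 * q + N$2$2 * s)
      - (N$1$1 * q + N$1$2 * s) * (N$2$1 * p + N$2$2 * r) > 0"
    using 1 assms by simp
  have "det (M ** N) = 1" using assms by (simp add: det_mul)
  then show ?thesis
    using 1 3 assms
    by (simp add: v tangent_act_frame matrix_matrix_mult_def sum_2 algebra_simps)
qed

lemma tangent_act_mat1:
  assumes "v \<in> T1H"
  shows "tangent_act (mat 1) v = v"
proof -
  obtain p q r s where 1: "p * s - q * r = 1" and v: "v = frame p q r s"
    using T1H_frame[OF assms] .
  then show ?thesis by (simp add: tangent_act_frame) (simp add: mat_def)
qed

section \<open>\<open>Theta\<close> as a group described by parities\<close>

lemma Theta_iff:
  "A \<in> Theta \<longleftrightarrow> A$1$1 * A$2$2 - A$1$2 * A$2$1 = 1 \<and>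
    (odd (A$1$1) \<and> even (A$1$2) \<and> even (A$2$1) \<and> odd (A$2$2) \<or>
     even (A$1$1) \<and> odd (A$1$2) \<and> odd (A$2$1) \<and> even (A$2$2))"
  by (auto simp: Theta_def congruent_mod2_def forall_2 det_2 mat_def
      even_iff_mod_2_eq_zero odd_iff_mod_2_eq_one)

lemma map_matrix_mult:
  fixes A B :: "int^2^2"
  shows "map_matrix real_of_int (A ** B) = map_matrix real_of_int A ** map_matrix real_of_int B"
  by (simp add: vec_eq_iff matrix_matrix_mult_def)

lemma Theta_det: "A \<in> Theta \<Longrightarrow> det (map_matrix real_of_int A) = 1"
  by (simp add: Theta_iff det_2 flip: of_int_mult of_int_diff)

lemma Theta_mult:
  assumes "A \<in> Theta" "B \<in> Theta"
  shows "A ** B \<in> Theta"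
proof -
  have "det (A ** B) = 1" using assms by (simp add: Theta_def det_mul)
  then show ?thesis
    using assms by (auto simp: Theta_iff det_2 matrix_matrix_mult_def sum_2)
qed

lemma Theta_one: "mat 1 \<in> Theta"
  by (simp add: Theta_iff mat_def)

lemma Theta_inverse:
  assumes "A \<in> Theta"
  obtains B where "B \<in> Theta" "B ** A = mat 1"
proof
  let ?B = "vector [vector [A$2$2, - A$1$2], vector [- A$2$1, A$1$1]] :: int^2^2"
  have det: "A$1$1 * A$2$2 - A$1$2 * A$2$1 = 1" using assms by (simp add: Theta_iff)
  then have det': "A$2$2 * A$1$1 - A$1$2 * A$2$1 = 1" "A$1$1 * A$2$2 - A$2$1 * A$1$2 = 1"
    by (simp_all only: mult.commute)
  show "?B \<in> Theta" using assms det' by (auto simp: Theta_iff)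
  show "?B ** A = mat 1"
    using det' by (simp add: vec_eq_iff forall_2 matrix_matrix_mult_def sum_2 mat_def)
qed

lemma map_matrix_mat1: "map_matrix real_of_int (mat 1) = mat 1"
  by (simp add: vec_eq_iff mat_def)

section \<open>Orbits of unit tangent vectors\<close>

lemma tangent_act_Theta_mult:
  assumes "v \<in> T1H" "A \<in> Theta" "B \<in> Theta"
  shows "tangent_act (map_matrix real_of_int (A ** B)) v
    = tangent_act (map_matrix real_of_int A) (tangent_act (map_matrix real_of_int B) v)"
  using assms by (simp add: map_matrix_mult tangent_act_mult Theta_det)

lemma self_in_proj: "v \<in> T1H \<Longrightarrow> v \<in> proj v"
  unfolding proj_def
  by (rule image_eqI[OF _ Theta_one]) (simp only: map_matrix_mat1 tangent_act_mat1)

lemma proj_Theta: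
  assumes "v \<in> T1H" "A \<in> Theta"
  shows "proj (tangent_act (map_matrix real_of_int A) v) = proj v"
proof
  show "proj (tangent_act (map_matrix real_of_int A) v) \<subseteq> proj v"
  proof
    fix w assume "w \<in> proj (tangent_act (map_matrix real_of_int A) v)"
    then obtain B where B: "B \<in> Theta"
      "w = tangent_act (map_matrix real_of_int B) (tangent_act (map_matrix real_of_int A) v)"
      by (auto simp: proj_def)
    then have "w = tangent_act (map_matrix real_of_int (B ** A)) v"
      by (simp only: tangent_act_Theta_mult[OF assms(1) B(1) assms(2)])
    then show "w \<in> proj v" using Theta_mult[OF B(1) assms(2)] by (auto simp: proj_def)
  qed
  obtain C where C: "C \<in> Theta" "C ** A = mat 1" using Theta_inverse[OF assms(2)] .
  show "proj v \<subseteq> proj (tangent_act (map_matrix real_of_int A) v)"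
  proof
    fix w assume "w \<in> proj v"
    then obtain B where B: "B \<in> Theta" "w = tangent_act (map_matrix real_of_int B) v"
      by (auto simp: proj_def)
    have "B = (B ** C) ** A" using C by (metis matrix_mul_assoc matrix_mul_rid)
    then have "w = tangent_act (map_matrix real_of_int (B ** C))
        (tangent_act (map_matrix real_of_int A) v)"
      using B C assms by (metis tangent_act_Theta_mult Theta_mult)
    then show "w \<in> proj (tangent_act (map_matrix real_of_int A) v)"
      using B C Theta_mult by (auto simp: proj_def)
  qed
qed

lemma quotient_flow_proj:
  assumes "v \<in> T1H"
  shows "quotient_flow t (proj v) = proj (geodesic_flow t v)"
  using assms by (simp add: quotient_flow_def proj_def image_image tangent_act_T1H Theta_det)

lemma proj_mem_image_iff:
  assumes "v \<in> T1H" "S \<subseteq> T1H"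
  shows "proj v \<in> proj ` S \<longleftrightarrow> (\<exists>A\<in>Theta. tangent_act (map_matrix real_of_int A) v \<in> S)"
proof
  assume "proj v \<in> proj ` S"
  then obtain w where w: "w \<in> S" "proj w = proj v" by auto
  then have "w \<in> proj v" using self_in_proj assms by blast
  then show "\<exists>A\<in>Theta. tangent_act (map_matrix real_of_int A) v \<in> S"
    using w by (auto simp: proj_def)
next
  assume "\<exists>A\<in>Theta. tangent_act (map_matrix real_of_int A) v \<in> S"
  then show "proj v \<in> proj ` S" using proj_Theta[OF assms(1)] by (metis image_eqI)
qed

lemma fst_tangent_act_Theta:
  "fst (tangent_act (map_matrix real_of_int A) v)
    = (of_int (A$1$1) * fst v + of_int (A$1$2)) / (of_int (A$2$1) * fst v + of_int (A$2$2))"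
  by (simp add: tangent_act_def mob_def moebius_def)

text \<open>A matrix carries \<open>z\<close> to the line over \<open>e\<close> iff \<open>z\<close> lies on a circle orthogonal to the real axis,
  here written as the zero set of \<open>(a - e c) c |z|\<^sup>2 + \<dots>\<close>.\<close>

lemma Re_moebius_eq_imp:
  fixes a b c d e :: int and z :: complex
  assumes "Re ((of_int a * z + of_int b) / (of_int c * z + of_int d)) = of_int e"
    and "Im z > 0" "a * d - b * c = 1"
  shows "of_int ((a - e * c) * c) * ((Re z)\<^sup>2 + (Im z)\<^sup>2)
    + of_int (1 + 2 * ((b - e * d) * c)) * Re z + of_int ((b - e * d) * d) = (0::real)"
proof -
  let ?n = "of_int a * z + of_int b" and ?m = "of_int c * z + of_int d"
  have "c \<noteq> 0 \<or> d \<noteq> 0" using assms(3) by auto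
  then have "?m \<noteq> 0" using assms(2) by (auto simp: complex_eq_iff)
  then have m: "(Re ?m)\<^sup>2 + (Im ?m)\<^sup>2 > 0"
    by (auto simp: complex_eq_iff sum_power2_gt_zero_iff)
  have "Re ?n * Re ?m + Im ?n * Im ?m = of_int e * ((Re ?m)\<^sup>2 + (Im ?m)\<^sup>2)"
    using assms(1) m by (simp only: Re_divide) (simp add: field_simps)
  moreover have "1 = real_of_int a * real_of_int d - real_of_int b * real_of_int c"
    by (metis assms(3) of_int_1 of_int_diff of_int_mult)
  ultimately show ?thesis by simp algebra
qed

text \<open>The points that \<open>A\<close> sends over \<open>e\<close> form the geodesic with ends
  \<open>-v/u\<close> and \<open>-d/c\<close>, given by the form
  \<open>P N + (1 + 2m) Re z + R\<close> of discriminant \<open>(1 + 2m)^2 - 4PR = 1\<close>. On the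
  quadrilateral -1, 0, 1, infinity such a form can vanish only if \<open>P = R = 0\<close>, that is,
  on the line over 0; this line is excluded by the parities of \<open>A\<close> and
  \<open>e\<close>.\<close>

lemma no_Theta_crossing:
  fixes z :: complex
  assumes "A \<in> Theta" "odd e" "Im z > 0" "\<bar>Re z\<bar> < 1" "(Re z)\<^sup>2 + (Im z)\<^sup>2 > \<bar>Re z\<bar>"
  shows "Re ((of_int (A$1$1) * z + of_int (A$1$2)) / (of_int (A$2$1) * z + of_int (A$2$2)))
    \<noteq> of_int e"
proof
  let ?a = "A$1$1" and ?b = "A$1$2" and ?c = "A$2$1" and ?d = "A$2$2"
  assume "Re ((of_int ?a * z + of_int ?b) / (of_int ?c * z + of_int ?d)) = of_int e"
  moreover have det: "?a * ?d - ?b * ?c = 1" using assms(1) by (simp add: Theta_iff)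
  define u v where "u = ?a - e * ?c" and "v = ?b - e * ?d"
  define P R m where "P = u * ?c" and "R = v * ?d" and "m = v * ?c"
  define N where "N = (Re z)\<^sup>2 + (Im z)\<^sup>2"
  ultimately have Q: "of_int P * N + of_int (1 + 2 * m) * Re z + of_int R = 0"
    using Re_moebius_eq_imp[OF _ assms(3) det] unfolding u_def v_def P_def R_def m_def N_def by blast
  have ud: "u * ?d = m + 1" using det by (simp add: u_def v_def m_def algebra_simps)
  have par: "even (u + v)" "odd (?c + ?d)"
    using assms(1,2) by (auto simp: Theta_iff u_def v_def)
  have "P * R = (u * ?d) * (v * ?c)" by (simp add: P_def R_def)
  then have PR: "P * R = m * (m + 1)" by (simp add: ud m_def)
  have same: "\<bar>P\<bar> * \<bar>R\<bar> = P * R"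
  proof -
    have "m * (m + 1) \<ge> 0" by (cases "m \<ge> 0") (auto intro: mult_nonpos_nonpos)
    then show ?thesis by (simp add: PR flip: abs_mult)
  qed
  show False
  proof (cases "P = 0")
    \<comment> \<open>The form reduces to \<open>R\<close> plus or minus \<open>Re z\<close>, and
      \<open>|Re z| < 1\<close> makes the integer \<open>R\<close> vanish. The geodesic is then the
      line over 0, whose ends have the wrong parities.\<close>
    case True
    then have "m = 0 \<or> m = -1" using PR by auto
    then have "\<bar>real_of_int R\<bar> = \<bar>Re z\<bar>" using Q True by auto
    then have "R = 0" using assms(4) by linarith
    with True consider "u = 0" "v * ?c = -1" | "?c = 0" "u * ?d = 1" "v = 0"
      using ud by (auto simp: P_def R_def m_def)
    then show False
    proof cases
      case 1
      then have "odd v" by (metis even_minus even_mult_iff odd_one)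
      then show False using par 1 by auto
    next
      case 2
      then have "odd u" by (metis even_mult_iff odd_one)
      then show False using par 2 by auto
    qed
  next
    case False
    define x p r where "x = Re z" and "p = \<bar>real_of_int P\<bar>" and "r = \<bar>real_of_int R\<bar>"
    have p: "p > 0" "r \<ge> 0" using False by (auto simp: p_def r_def)
    have N: "N > \<bar>x\<bar>" "\<bar>x\<bar> < 1" using assms by (auto simp: N_def x_def)
    have "p * r = of_int P * of_int R"
      using same by (simp add: p_def r_def flip: of_int_abs of_int_mult)
    \<comment> \<open>\<open>P\<close> and \<open>R\<close> do not have opposite signs and
      \<open>N\<close> is positive, so absolute values can be taken termwise in
      \<open>P N + R\<close>.\<close>
    then have "of_int P * N * of_int R \<ge> 0"
      using p N by (simp add: mult.assoc mult.left_commute[of _ N] mult.commute[of _ N])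
         (metis abs_ge_zero less_eq_real_def less_le_trans mult_nonneg_nonneg)
    moreover have "\<bar>g + h\<bar> = \<bar>g\<bar> + \<bar>h\<bar>" if "g * h \<ge> 0" for g h :: real
      using that by (auto simp: zero_le_mult_iff)
    ultimately have "\<bar>of_int P * N + of_int R\<bar> = \<bar>of_int P * N\<bar> + \<bar>real_of_int R\<bar>"
      by blast
    then have "p * N + r = \<bar>of_int P * N + of_int R\<bar>"
      using N by (simp add: p_def r_def abs_mult)
    also have "of_int P * N + of_int R = - (of_int (1 + 2 * m) * x)"
      using Q unfolding x_def by linarith
    finally have eq: "p * N + r = \<bar>of_int (1 + 2 * m)\<bar> * \<bar>x\<bar>" by (simp only: abs_minus abs_mult)
    have x0: "\<bar>x\<bar> > 0"
    proof (rule ccontr)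
      assume "\<not> \<bar>x\<bar> > 0"
      then have "p * N + r = 0" "N > 0" using eq N by auto
      then show False using p by (smt (verit) mult_pos_pos)
    qed
    \<comment> \<open>The position of \<open>z\<close> enters here: \<open>N > |x|\<close> bounds
      the first term and \<open>|x| < 1\<close> the second.\<close>
    have "(p + r) * \<bar>x\<bar> < p * N + r"
    proof -
      have "p * \<bar>x\<bar> < p * N" using p N by simp
      moreover have "r * \<bar>x\<bar> \<le> r" using p N by (simp add: mult_left_le)
      ultimately show ?thesis by (simp add: distrib_right)
    qed
    then have "p + r < \<bar>of_int (1 + 2 * m)\<bar>" using eq x0 by simp
    then have lt: "\<bar>P\<bar> + \<bar>R\<bar> < \<bar>1 + 2 * m\<bar>" unfolding p_def r_def by linarith
    \<comment> \<open>Squaring and subtracting \<open>4 |P| |R| = 4PR\<close> compares with the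
      discriminant 1, so the integers \<open>|P|\<close> and \<open>|R|\<close> are at distance less
      than 1.\<close>
    then have "(\<bar>P\<bar> + \<bar>R\<bar>)\<^sup>2 < \<bar>1 + 2 * m\<bar>\<^sup>2"
      by (intro power_strict_mono) auto
    then have "(\<bar>P\<bar> + \<bar>R\<bar>)\<^sup>2 < (1 + 2 * m)\<^sup>2" by simp
    also have "\<dots> = 4 * (P * R) + 1" by (simp add: PR power2_eq_square algebra_simps)
    finally have "(\<bar>P\<bar> - \<bar>R\<bar>)\<^sup>2 < 1"
      unfolding same[symmetric] by (simp add: power2_eq_square algebra_simps)
    then have "\<bar>P\<bar> = \<bar>R\<bar>" by (smt (verit) zero_less_power2)
    then have "P * P = m * (m + 1)" using PR same by (metis abs_mult_self_eq)
    \<comment> \<open>\<open>4 P^2 + 1\<close> is a square only for \<open>P = 0\<close>: two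
      integers with product 1 coincide.\<close>
    then have "(1 + 2 * m - 2 * P) * (1 + 2 * m + 2 * P) = 1" by (simp add: algebra_simps)
    then have "1 + 2 * m - 2 * P = 1 + 2 * m + 2 * P" by (auto simp: zmult_eq_1_iff)
    then show False using False by simp
  qed
qed

text \<open>A translate of an odd vertical line that meets an odd vertical line coincides with it,
  and the two ends cannot be interchanged because infinity and an odd integer are inequivalent
  cusps. So \<open>A\<close> fixes infinity.\<close>

lemma odd_line_stabilizer:
  fixes z :: complex
  assumes "A \<in> Theta" "odd e" "odd f" "Im z > 0" "Re z = of_int f"
    and "Re ((of_int (A$1$1) * z + of_int (A$1$2)) / (of_int (A$2$1) * z + of_int (A$2$2)))
      = of_int e"
  shows "A$2$1 = 0"
proof (rule ccontr)
  let ?a = "A$1$1" and ?b = "A$1$2" and ?c = "A$2$1" and ?d = "A$2$2"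
  assume c: "?c \<noteq> 0"
  have det: "?a * ?d - ?b * ?c = 1" using assms(1) by (simp add: Theta_iff)
  define u v where "u = ?a - e * ?c" and "v = ?b - e * ?d"
  have ud: "u * ?d = v * ?c + 1" using det by (simp add: u_def v_def algebra_simps)
  define k where "k = (u * f + v) * ?c"
  have par: "even (u * f + v)" using assms(1-3) by (auto simp: Theta_iff u_def v_def)
  have k1: "u * (?c * f + ?d) = k + 1" using ud by (simp add: k_def algebra_simps)
  have "of_int (u * ?c) * ((of_int f)\<^sup>2 + (Im z)\<^sup>2) + of_int (1 + 2 * (v * ?c)) * of_int f
      + of_int (v * ?d) = (0::real)"
    using Re_moebius_eq_imp[OF assms(6,4) det] unfolding assms(5) u_def v_def by blast
  moreover have "(u * f + v) * (?c * f + ?d) = u * ?c * f\<^sup>2 + (1 + 2 * (v * ?c)) * f + v * ?d"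
    using ud by algebra
  ultimately have "of_int (u * ?c) * (Im z)\<^sup>2 + of_int ((u * f + v) * (?c * f + ?d)) = (0::real)"
    by (simp add: algebra_simps)
  \<comment> \<open>Multiplied by \<open>u c\<close>, the equation reads
    \<open>(u c Im z)^2 + k (k + 1) = 0\<close>. Both terms are nonnegative because \<open>k\<close>
    is an integer, so \<open>u = 0\<close>; only the interchange of the two ends is left, and parity
    rules it out.\<close>
  then have "of_int (u * ?c) * (of_int (u * ?c) * (Im z)\<^sup>2
      + of_int ((u * f + v) * (?c * f + ?d))) = (0::real)" by simp
  moreover have "u * ?c * ((u * f + v) * (?c * f + ?d)) = k * (k + 1)"
    unfolding k1[symmetric] by (simp add: k_def mult_ac)
  ultimately have eq: "(of_int (u * ?c) * Im z)\<^sup>2 + of_int (k * (k + 1)) = (0::real)"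
    by (simp only: distrib_left power_mult_distrib power2_eq_square flip: of_int_mult)
       (simp add: algebra_simps)
  have "k * (k + 1) \<ge> 0" by (cases "k \<ge> 0") (auto intro: mult_nonpos_nonpos)
  then have "real_of_int (k * (k + 1)) \<ge> 0" by (simp only: of_int_0_le_iff)
  then have "(of_int (u * ?c) * Im z)\<^sup>2 = (0::real)" "real_of_int (k * (k + 1)) = 0"
    using eq by (smt (verit) zero_le_power2)+
  then have "u = 0" "k = 0 \<or> k = -1" using c assms(4) by (auto simp del: of_int_mult)
  then have "v * ?c = -1" "even v" using k1 par by (auto simp: k_def)
  then show False by (metis even_minus even_mult_iff odd_one)
qed

section \<open>Endpoints\<close>

lemma tendsto_frame_at_top:
  assumes "p * s - q * r > 0"
  shows "((\<lambda>t. fst (frame (exp t * p) q (exp t * r) s)) \<longlongrightarrow> of_real a) at_top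
    \<longleftrightarrow> r \<noteq> 0 \<and> a = p / r"
proof (cases "r = 0")
  case True
  then have ps: "p / s > 0" using assms by (simp add: zero_less_divide_iff zero_less_mult_iff)
  have "Im (fst (frame (exp t * p) q (exp t * r) s)) = (p / s) * exp t" for t
    using True ps by (simp add: frame_def Im_divide power2_eq_square)
  moreover have "filterlim (\<lambda>t. (p / s) * exp t) at_top at_top"
    using ps exp_at_top by (intro filterlim_tendsto_pos_mult_at_top[OF tendsto_const])
  ultimately have lim: "filterlim (\<lambda>t. Im (fst (frame (exp t * p) q (exp t * r) s))) at_top at_top"
    by simp
  have "\<not> ((\<lambda>t. fst (frame (exp t * p) q (exp t * r) s)) \<longlongrightarrow> of_real a) at_top"
  proof
    assume "((\<lambda>t. fst (frame (exp t * p) q (exp t * r) s)) \<longlongrightarrow> of_real a) at_top"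
    then have "((\<lambda>t. Im (fst (frame (exp t * p) q (exp t * r) s))) \<longlongrightarrow> Im (of_real a)) at_top"
      by (rule tendsto_Im)
    then show False
      using lim not_tendsto_and_filterlim_at_infinity filterlim_at_top_imp_at_infinity
        trivial_limit_at_top_linorder by blast
  qed
  then show ?thesis using True by simp
next
  case False
  \<comment> \<open>Numerator and denominator are divided by \<open>exp t\<close>, so that each
    converges.\<close>
  have "fst (frame (exp t * p) q (exp t * r) s)
      = (of_real (q * exp (- t)) + \<i> * of_real p) / (of_real (s * exp (- t)) + \<i> * of_real r)" for t
  proof -
    have "exp t * (x * exp (- t)) = x" for x :: real
      by (metis exp_minus_inverse mult.left_commute mult.right_neutral)
    then have "Complex q (exp t * p) = of_real (exp t) * (of_real (q * exp (- t)) + \<i> * of_real p)"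
      "Complex s (exp t * r) = of_real (exp t) * (of_real (s * exp (- t)) + \<i> * of_real r)"
      by (simp_all add: complex_eq_iff)
    then show ?thesis by (simp add: frame_def)
  qed
  moreover have "((\<lambda>t. (of_real (q * exp (- t)) + \<i> * of_real p)
      / (of_real (s * exp (- t)) + \<i> * of_real r))
    \<longlongrightarrow> (of_real (q * 0) + \<i> * of_real p) / (of_real (s * 0) + \<i> * of_real r :: complex)) at_top"
    using False
    by (intro tendsto_intros filterlim_compose[OF exp_at_bot filterlim_uminus_at_bot_at_top]) auto
  ultimately have lim: "((\<lambda>t. fst (frame (exp t * p) q (exp t * r) s)) \<longlongrightarrow> of_real (p / r)) at_top"
    by simp
  have "complex_of_real a = of_real (p / r)"
    if "((\<lambda>t. fst (frame (exp t * p) q (exp t * r) s)) \<longlongrightarrow> of_real a) at_top"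
    using that lim by (rule tendsto_unique[OF trivial_limit_at_top_linorder])
  then have "a = p / r"
    if "((\<lambda>t. fst (frame (exp t * p) q (exp t * r) s)) \<longlongrightarrow> of_real a) at_top"
    using that by (simp only: of_real_eq_iff)
  with lim False show ?thesis by blast
qed

lemma tendsto_frame_at_bot:
  assumes "p * s - q * r > 0"
  shows "((\<lambda>t. fst (frame (exp t * p) q (exp t * r) s)) \<longlongrightarrow> of_real b) at_bot
    \<longleftrightarrow> s \<noteq> 0 \<and> b = q / s"
proof (cases "s = 0")
  case True
  then have qr: "q / r < 0" using assms by (simp add: divide_less_0_iff mult_less_0_iff)
  have "Im (fst (frame (exp t * p) q (exp t * r) s)) = - (q / r) * exp (- t)" for t
    using True qr by (simp add: frame_def Im_divide power2_eq_square exp_minus field_simps)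
  moreover have "filterlim (\<lambda>t. - (q / r) * exp (- t)) at_top at_bot"
    using qr
    by (intro filterlim_tendsto_pos_mult_at_top[OF tendsto_const]
        filterlim_compose[OF exp_at_top filterlim_uminus_at_top_at_bot]) auto
  ultimately have lim: "filterlim (\<lambda>t. Im (fst (frame (exp t * p) q (exp t * r) s))) at_top at_bot"
    by simp
  have "\<not> ((\<lambda>t. fst (frame (exp t * p) q (exp t * r) s)) \<longlongrightarrow> of_real b) at_bot"
  proof
    assume "((\<lambda>t. fst (frame (exp t * p) q (exp t * r) s)) \<longlongrightarrow> of_real b) at_bot"
    then have "((\<lambda>t. Im (fst (frame (exp t * p) q (exp t * r) s))) \<longlongrightarrow> Im (of_real b)) at_bot"
      by (rule tendsto_Im)
    then show False
      using lim not_tendsto_and_filterlim_at_infinity filterlim_at_top_imp_at_infinity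
        trivial_limit_at_bot_linorder by blast
  qed
  then show ?thesis using True by simp
next
  case False
  have "fst (frame (exp t * p) q (exp t * r) s)
      = (of_real q + \<i> * of_real (exp t * p)) / (of_real s + \<i> * of_real (exp t * r))" for t
    unfolding frame_def fst_conv Complex_eq ..
  moreover have "((\<lambda>t. (of_real q + \<i> * of_real (exp t * p)) / (of_real s + \<i> * of_real (exp t * r)))
    \<longlongrightarrow> (of_real q + \<i> * of_real (0 * p)) / (of_real s + \<i> * of_real (0 * r) :: complex)) at_bot"
    using False by (intro tendsto_intros exp_at_bot) auto
  ultimately have lim: "((\<lambda>t. fst (frame (exp t * p) q (exp t * r) s)) \<longlongrightarrow> of_real (q / s)) at_bot"
    by simp
  have "complex_of_real b = of_real (q / s)"
    if "((\<lambda>t. fst (frame (exp t * p) q (exp t * r) s)) \<longlongrightarrow> of_real b) at_bot"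
    using that lim by (rule tendsto_unique[OF trivial_limit_at_bot_linorder])
  then have "b = q / s"
    if "((\<lambda>t. fst (frame (exp t * p) q (exp t * r) s)) \<longlongrightarrow> of_real b) at_bot"
    using that by (simp only: of_real_eq_iff)
  with lim False show ?thesis by blast
qed

lemma has_forward_end_frame:
  assumes "p * s - q * r > 0"
  shows "has_forward_end (geodesic_of (frame p q r s)) a \<longleftrightarrow> r \<noteq> 0 \<and> a = p / r"
  using assms frame_flow_det[OF assms] tendsto_frame_at_top[OF frame_flow_det[OF assms]]
  by (simp add: has_forward_end_def geodesic_of_def geodesic_flow_frame)

lemma has_backward_end_frame:
  assumes "p * s - q * r > 0"
  shows "has_backward_end (geodesic_of (frame p q r s)) b \<longleftrightarrow> s \<noteq> 0 \<and> b = q / s"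
  using assms frame_flow_det[OF assms] tendsto_frame_at_bot[OF frame_flow_det[OF assms]]
  by (simp add: has_backward_end_def geodesic_of_def geodesic_flow_frame)

text \<open>The vectors on the geodesic from \<open>j b\<close> to \<open>j a\<close>, where the sign \<open>j\<close> treats \<open>X_plus\<close> and
  \<open>X_minus\<close> simultaneously.\<close>

definition arc :: "real \<Rightarrow> real \<Rightarrow> int \<Rightarrow> real \<Rightarrow> tvec" where
  "arc a b j \<tau> = frame (a * \<tau>) (of_int j * b) (of_int j * \<tau>) 1"

lemma arc_det:
  fixes a b \<tau> :: real
  assumes "a > b" "\<tau> > 0" "j \<in> {1, -1}"
  shows "a * \<tau> * 1 - of_int j * b * (of_int j * \<tau>) > 0"
proof -
  have "a * \<tau> - b * \<tau> = (a - b) * \<tau>" by (simp add: algebra_simps)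
  also have "\<dots> > 0" by (rule mult_pos_pos) (use assms in auto)
  finally show ?thesis using assms by auto
qed

lemma arc_T1H: "a > b \<Longrightarrow> \<tau> > 0 \<Longrightarrow> j \<in> {1, -1} \<Longrightarrow> arc a b j \<tau> \<in> T1H"
  unfolding arc_def by (intro frame_in_T1H arc_det)

lemma geodesic_flow_arc:
  assumes "a > b" "\<tau> > 0" "j \<in> {1, -1}"
  shows "geodesic_flow t (arc a b j \<tau>) = arc a b j (exp t * \<tau>)"
  using geodesic_flow_frame[OF arc_det[OF assms]] by (simp add: arc_def mult_ac)

lemma arc_ends:
  assumes "a > b" "\<tau> > 0" "j \<in> {1, -1}"
  shows "has_forward_end (geodesic_of (arc a b j \<tau>)) x \<longleftrightarrow> x = of_int j * a"
    and "has_backward_end (geodesic_of (arc a b j \<tau>)) y \<longleftrightarrow> y = of_int j * b"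
    and "forward_end (geodesic_of (arc a b j \<tau>)) = of_int j * a"
    and "backward_end (geodesic_of (arc a b j \<tau>)) = of_int j * b"
    and "ends_in (geodesic_of (arc a b j \<tau>)) S \<longleftrightarrow> (of_int j * a, of_int j * b) \<in> S"
proof -
  show 1: "has_forward_end (geodesic_of (arc a b j \<tau>)) x \<longleftrightarrow> x = of_int j * a" for x
    using has_forward_end_frame[OF arc_det[OF assms]] assms by (auto simp: arc_def)
  show 2: "has_backward_end (geodesic_of (arc a b j \<tau>)) y \<longleftrightarrow> y = of_int j * b" for y
    using has_backward_end_frame[OF arc_det[OF assms]] by (simp add: arc_def)
  show "forward_end (geodesic_of (arc a b j \<tau>)) = of_int j * a"
    "backward_end (geodesic_of (arc a b j \<tau>)) = of_int j * b"
    "ends_in (geodesic_of (arc a b j \<tau>)) S \<longleftrightarrow> (of_int j * a, of_int j * b) \<in> S"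
    by (simp_all add: forward_end_def backward_end_def ends_in_def 1 2)
qed

text \<open>The endpoints fix the ratios within the two columns of the matrix. Scaling
  \<open>s\<close> to 1 leaves the single parameter \<open>\<tau> = j r / s\<close>, which is
  positive because the determinant is.\<close>

lemma T1H_ends_imp_arc:
  assumes "v \<in> T1H" "has_forward_end (geodesic_of v) (of_int j * a)"
    "has_backward_end (geodesic_of v) (of_int j * b)" "a > b" "j \<in> {1, -1}"
  obtains \<tau> where "\<tau> > 0" "v = arc a b j \<tau>"
proof -
  obtain p q r s where 1: "p * s - q * r = 1" and v: "v = frame p q r s"
    using T1H_frame[OF assms(1)] .
  have r: "r \<noteq> 0" "of_int j * a = p / r" and s: "s \<noteq> 0" "of_int j * b = q / s"
    using assms(2,3) 1 by (simp_all add: v has_forward_end_frame has_backward_end_frame)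
  define \<tau> where "\<tau> = of_int j * r / s"
  have p: "p = of_int j * a * r" and q: "q = of_int j * b * s" using r s by (simp_all add: field_simps)
  have "1 = (a - b) * \<tau> * (s * s)"
    using 1 s unfolding p q \<tau>_def by (simp add: field_simps)
  moreover have "s * s > 0" "a - b > 0" using s assms by (simp_all add: zero_less_mult_iff linorder_neq_iff disj_commute)
  ultimately have "\<tau> > 0" by (metis mult_pos_pos zero_less_mult_pos zero_less_mult_pos2 zero_less_one)
  moreover have "v = arc a b j \<tau>"
  proof -
    have "arc a b j \<tau> = frame (s * (a * \<tau>)) (s * (of_int j * b)) (s * (of_int j * \<tau>)) (s * 1)"
      unfolding arc_def using frame_scale[OF s(1)] by metis
    also have "s * (a * \<tau>) = p" using s by (simp add: p \<tau>_def)
    also have "s * (of_int j * b) = q" by (simp add: q)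
    also have "s * (of_int j * \<tau>) = r" using s assms(5) by (auto simp: \<tau>_def)
    finally show ?thesis by (simp add: v)
  qed
  ultimately show ?thesis by (rule that)
qed

lemma fst_arc:
  assumes "j \<in> {1, -1}"
  shows "Re (fst (arc a b j \<tau>)) = of_int j * ((a * \<tau>\<^sup>2 + b) / (\<tau>\<^sup>2 + 1))"
    and "Im (fst (arc a b j \<tau>)) = (a - b) * \<tau> / (\<tau>\<^sup>2 + 1)"
  using assms by (auto simp: arc_def frame_def Re_divide Im_divide power2_eq_square field_simps)

lemma Re_arc_eq_iff:
  assumes "a > 1" "b < 1" "\<tau> > 0" "j \<in> {1, -1}"
  shows "Re (fst (arc a b j \<tau>)) = of_int j \<longleftrightarrow> \<tau> = sqrt ((1 - b) / (a - 1))"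
proof -
  have pos: "\<tau>\<^sup>2 + 1 > 0" by (simp add: add_nonneg_pos)
  have "Re (fst (arc a b j \<tau>)) = of_int j \<longleftrightarrow> (a * \<tau>\<^sup>2 + b) / (\<tau>\<^sup>2 + 1) = 1"
  proof -
    have "real_of_int j * x = of_int j \<longleftrightarrow> x = 1" for x using assms(4) by auto
    then show ?thesis unfolding fst_arc(1)[OF assms(4)] .
  qed
  also have "\<dots> \<longleftrightarrow> \<tau>\<^sup>2 = (1 - b) / (a - 1)"
    using pos assms by (simp add: field_simps) (auto simp: algebra_simps)
  also have "\<dots> \<longleftrightarrow> \<tau> = sqrt ((1 - b) / (a - 1))"
    using assms by (auto simp: real_sqrt_unique)
  finally show ?thesis .
qed

text \<open>By \<open>Re_arc_eq_iff\<close> this is where the geodesic crosses the line over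
  \<open>j\<close>. It is used for every \<open>b < 1\<close>, since the flow also passes through
  crossings that do not belong to \<open>X\<close>.\<close>

definition section_vec :: "real \<Rightarrow> real \<Rightarrow> int \<Rightarrow> tvec" where
  "section_vec a b j = arc a b j (sqrt ((1 - b) / (a - 1)))"

lemma section_vec_T1H: "a > 1 \<Longrightarrow> b < 1 \<Longrightarrow> j \<in> {1, -1} \<Longrightarrow> section_vec a b j \<in> T1H"
  unfolding section_vec_def by (rule arc_T1H) auto

lemma sqrt3_bounds: "1 < sqrt 3" "sqrt 3 < 2"
  by (auto intro: real_less_rsqrt real_less_lsqrt simp: power2_eq_square)

text \<open>\<open>I_minus\<close> is the negative of \<open>I_plus\<close>, so a single sign
  \<open>j\<close> covers both halves of the section.\<close>

lemma mem_X_iff: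
  "v \<in> X \<longleftrightarrow> (\<exists>a b j. a > 1 \<and> - sqrt 3 \<le> b \<and> b < 2 - sqrt 3 \<and> j \<in> {1, -1} \<and> v = section_vec a b j)"
proof
  assume v: "v \<in> X"
  then obtain j :: int and x y where j: "j \<in> {1, -1}" "Re (fst v) = of_int j"
      and ends: "has_forward_end (geodesic_of v) x" "has_backward_end (geodesic_of v) y"
      and xy: "of_int j * x > 1" "- sqrt 3 \<le> of_int j * y" "of_int j * y < 2 - sqrt 3"
      and T: "v \<in> T1H"
  proof (cases "v \<in> X_plus")
    case True
    then show ?thesis
      using that[of 1] by (auto simp: X_plus_def ends_in_def I_plus_def)
  next
    case False
    then have "v \<in> X_minus" using v by (simp add: X_def)
    then show ?thesis
      using that[of "-1"] by (fastforce simp: X_minus_def ends_in_def I_minus_def)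
  qed
  define a b where "a = of_int j * x" and "b = of_int j * y"
  have ab: "a > 1" "- sqrt 3 \<le> b" "b < 2 - sqrt 3" using xy by (simp_all add: a_def b_def)
  then have b1: "b < 1" using sqrt3_bounds by linarith
  have "x = of_int j * a" "y = of_int j * b" using j by (auto simp: a_def b_def)
  then obtain \<tau> where \<tau>: "\<tau> > 0" "v = arc a b j \<tau>"
    using T1H_ends_imp_arc[OF T _ _ _ j(1), of a b] ends ab b1 by auto
  then have "v = section_vec a b j"
    using Re_arc_eq_iff[OF ab(1) b1 \<tau>(1) j(1)] j unfolding section_vec_def by simp
  then show "\<exists>a b j. a > 1 \<and> - sqrt 3 \<le> b \<and> b < 2 - sqrt 3 \<and> j \<in> {1, -1} \<and> v = section_vec a b j"
    using ab j(1) by blast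
next
  assume "\<exists>a b j. a > 1 \<and> - sqrt 3 \<le> b \<and> b < 2 - sqrt 3 \<and> j \<in> {1, -1} \<and> v = section_vec a b j"
  then obtain a b j where ab: "a > 1" "- sqrt 3 \<le> b" "b < 2 - sqrt 3" "j \<in> {1, -1}"
      and v: "v = section_vec a b j" by blast
  have b1: "b < 1" using ab sqrt3_bounds by linarith
  define \<tau> where "\<tau> = sqrt ((1 - b) / (a - 1))"
  have \<tau>: "\<tau> > 0" using ab b1 by (simp add: \<tau>_def)
  have v': "v = arc a b j \<tau>" by (simp add: v \<tau>_def section_vec_def)
  have Re: "Re (fst v) = of_int j"
    using Re_arc_eq_iff[OF ab(1) b1 \<tau> ab(4)] by (simp add: v' \<tau>_def)
  have T: "v \<in> T1H" unfolding v using ab(1) b1 ab(4) by (rule section_vec_T1H)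
  have "b < a" using ab(1) b1 by linarith
  then have ends: "ends_in (geodesic_of v) S \<longleftrightarrow> (of_int j * a, of_int j * b) \<in> S" for S
    unfolding v' using \<tau> ab(4) by (rule arc_ends(5))
  show "v \<in> X"
  proof (cases "j = 1")
    case True
    then have "v \<in> X_plus"
      unfolding X_plus_def mem_Collect_eq ends I_plus_def using Re T ab by simp
    then show ?thesis by (simp add: X_def)
  next
    case False
    then have "j = -1" using ab(4) by simp
    then have "v \<in> X_minus"
      unfolding X_minus_def mem_Collect_eq ends I_minus_def using Re T ab by simp
    then show ?thesis by (simp add: X_def)
  qed
qed

section \<open>Crossings of the odd vertical lines\<close>

lemma X_subset_T1H: "X \<subseteq> T1H"
  by (auto simp: X_def X_plus_def X_minus_def)

section \<open>The moves as identities between Theta-orbits of arcs\<close>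

lemma tangent_act_Theta_arc:
  assumes "A \<in> Theta" "a > b" "\<tau> > 0" "j \<in> {1, -1}"
  shows "tangent_act (map_matrix real_of_int A) (arc a b j \<tau>) =
    frame (of_int (A$1$1) * (a * \<tau>) + of_int (A$1$2) * (of_int j * \<tau>))
          (of_int (A$1$1) * (of_int j * b) + of_int (A$1$2))
          (of_int (A$2$1) * (a * \<tau>) + of_int (A$2$2) * (of_int j * \<tau>))
          (of_int (A$2$1) * (of_int j * b) + of_int (A$2$2))"
  using tangent_act_frame[OF Theta_det[OF assms(1)] arc_det[OF assms(2-4)]] by (simp add: arc_def)

lemma Theta_translation: "even n \<Longrightarrow> vector [vector [1, n], vector [0, 1]] \<in> Theta"
  by (simp add: Theta_iff)

lemma Theta_inversion: "vector [vector [0, -1], vector [1, 0]] \<in> Theta"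
  by (simp add: Theta_iff)

lemma proj_arc_translate:
  assumes "a > b" "\<tau> > 0" "j \<in> {1, -1}"
  shows "proj (arc a b j \<tau>) = proj (arc (a - 2) (b - 2) j \<tau>)"
proof -
  let ?A = "vector [vector [1, - 2 * j], vector [0, 1]] :: int^2^2"
  have A: "?A \<in> Theta" by (rule Theta_translation) simp
  have "tangent_act (map_matrix real_of_int ?A) (arc a b j \<tau>) = arc (a - 2) (b - 2) j \<tau>"
    unfolding tangent_act_Theta_arc[OF A assms] using assms(3)
    by (auto simp: arc_def algebra_simps)
  then show ?thesis using proj_Theta[OF arc_T1H[OF assms] A] by simp
qed

text \<open>The map \<open>-1/z\<close> sends the ends \<open>j a\<close>, \<open>j b\<close> to
  \<open>-j/a\<close>, \<open>-j/b\<close>. For \<open>a > 0\<close> a positive forward coordinate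
  requires the sign \<open>-j\<close>; in the companion lemma for \<open>a < 0\<close> the sign is
  kept and the coordinates are negated instead. Division by the last matrix entry restores the form
  of an arc and yields the new parameter.\<close>

lemma proj_arc_invert_opposite:
  assumes "a > 0" "b < 0" "\<tau> > 0" "j \<in> {1, -1}"
  shows "proj (arc a b j \<tau>) = proj (arc (1 / a) (1 / b) (- j) (- a * \<tau> / b))"
proof -
  let ?A = "vector [vector [0, -1], vector [1, 0]] :: int^2^2"
  have ab: "a > b" using assms by linarith
  have l: "1 / (of_int j * b) \<noteq> 0" using assms by auto
  have "tangent_act (map_matrix real_of_int ?A) (arc a b j \<tau>)
      = frame (- (of_int j * \<tau>)) (- 1) (a * \<tau>) (of_int j * b)"
    unfolding tangent_act_Theta_arc[OF Theta_inversion ab assms(3,4)] by simp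
  also have "\<dots> = frame (1 / (of_int j * b) * (- (of_int j * \<tau>))) (1 / (of_int j * b) * (- 1))
      (1 / (of_int j * b) * (a * \<tau>)) (1 / (of_int j * b) * (of_int j * b))"
    using frame_scale[OF l] by metis
  also have "\<dots> = arc (1 / a) (1 / b) (- j) (- a * \<tau> / b)"
    using assms by (auto simp: arc_def)
  finally show ?thesis using proj_Theta[OF arc_T1H[OF ab assms(3,4)] Theta_inversion] by simp
qed

lemma proj_arc_invert_same:
  assumes "a > b" "a < 0" "\<tau> > 0" "j \<in> {1, -1}"
  shows "proj (arc a b j \<tau>) = proj (arc (- 1 / a) (- 1 / b) j (a * \<tau> / b))"
proof -
  let ?A = "vector [vector [0, -1], vector [1, 0]] :: int^2^2"
  have b: "b < 0" using assms by linarith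
  have l: "1 / (of_int j * b) \<noteq> 0" using assms by auto
  have "tangent_act (map_matrix real_of_int ?A) (arc a b j \<tau>)
      = frame (- (of_int j * \<tau>)) (- 1) (a * \<tau>) (of_int j * b)"
    unfolding tangent_act_Theta_arc[OF Theta_inversion assms(1,3,4)] by simp
  also have "\<dots> = frame (1 / (of_int j * b) * (- (of_int j * \<tau>))) (1 / (of_int j * b) * (- 1))
      (1 / (of_int j * b) * (a * \<tau>)) (1 / (of_int j * b) * (of_int j * b))"
    using frame_scale[OF l] by metis
  also have "\<dots> = arc (- 1 / a) (- 1 / b) j (a * \<tau> / b)"
    using assms b by (auto simp: arc_def)
  finally show ?thesis using proj_Theta[OF arc_T1H[OF assms(1,3,4)] Theta_inversion] by simp
qed

text \<open>The set \<open>|Re z| < 1, |z|\<^sup>2 > |Re z|\<close> is the ideal quadrilateral with vertices \<open>-1, 0, 1, \<infinity>\<close>; its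
  sides are \<open>Theta\<close>-translates of the line over \<open>1\<close>, which does not enter its interior.\<close>

lemma proj_arc_notin_X:
  assumes "a > b" "\<tau> > 0" "j \<in> {1, -1}"
    and "\<bar>a * \<tau>\<^sup>2 + b\<bar> < \<tau>\<^sup>2 + 1" "\<bar>a * \<tau>\<^sup>2 + b\<bar> < a\<^sup>2 * \<tau>\<^sup>2 + b\<^sup>2"
  shows "proj (arc a b j \<tau>) \<notin> proj ` X"
proof
  define z where "z = fst (arc a b j \<tau>)"
  define D where "D = \<tau>\<^sup>2 + 1"
  have D: "D > 0" by (simp add: D_def add_nonneg_pos)
  have Re: "Re z = of_int j * ((a * \<tau>\<^sup>2 + b) / D)" and Im: "Im z = (a - b) * \<tau> / D"
    using fst_arc[OF assms(3)] by (simp_all add: z_def D_def)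
  have Im0: "Im z > 0"
    unfolding Im using assms(1,2) D by (intro divide_pos_pos mult_pos_pos) auto
  have absRe: "\<bar>Re z\<bar> = \<bar>a * \<tau>\<^sup>2 + b\<bar> / D" using assms(3) D by (auto simp: Re abs_mult)
  have j2: "(real_of_int j)\<^sup>2 = 1" using assms(3) by auto
  have "(Re z)\<^sup>2 + (Im z)\<^sup>2 = ((a * \<tau>\<^sup>2 + b)\<^sup>2 + ((a - b) * \<tau>)\<^sup>2) / D\<^sup>2"
    unfolding Re Im power_mult_distrib[of "of_int j"] power_divide j2
    by (simp add: add_divide_distrib)
  \<comment> \<open>The factor \<open>D\<close> cancels once, so that \<open>|z|^2 > |Re z|\<close>
    becomes exactly the second inequality of the hypotheses.\<close>
  also have "(a * \<tau>\<^sup>2 + b)\<^sup>2 + ((a - b) * \<tau>)\<^sup>2 = (a\<^sup>2 * \<tau>\<^sup>2 + b\<^sup>2) * D"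
    by (simp add: D_def power2_eq_square algebra_simps)
  finally have N: "(Re z)\<^sup>2 + (Im z)\<^sup>2 = (a\<^sup>2 * \<tau>\<^sup>2 + b\<^sup>2) / D"
    using D by (simp add: power2_eq_square)
  have quad: "\<bar>Re z\<bar> < 1" "(Re z)\<^sup>2 + (Im z)\<^sup>2 > \<bar>Re z\<bar>"
    unfolding N absRe using assms(4,5) D by (simp_all add: D_def divide_strict_right_mono)
  assume "proj (arc a b j \<tau>) \<in> proj ` X"
  then obtain A where A: "A \<in> Theta" "tangent_act (map_matrix real_of_int A) (arc a b j \<tau>) \<in> X"
    using proj_mem_image_iff[OF arc_T1H[OF assms(1-3)] X_subset_T1H] by blast
  then have "\<exists>e\<in>{1, -1}. Re (fst (tangent_act (map_matrix real_of_int A) (arc a b j \<tau>))) = of_int e"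
    by (auto simp: X_def X_plus_def X_minus_def)
  then obtain e where "e \<in> {1, -1}"
    "Re (fst (tangent_act (map_matrix real_of_int A) (arc a b j \<tau>))) = of_int e" by blast
  moreover have "odd e" using calculation(1) by auto
  ultimately show False
    using no_Theta_crossing[OF A(1) _ Im0 quad] unfolding fst_tangent_act_Theta z_def by blast
qed

text \<open>By \<open>odd_line_stabilizer\<close> the element is a translation up to sign. A
  translation between the lines over 1 and -1 would turn a geodesic that crosses away from 0 into
  one that crosses toward 0, so it must be trivial.\<close>

lemma section_unique:
  assumes "A \<in> Theta" "tangent_act (map_matrix real_of_int A) (section_vec a b j) = section_vec a' b' j'"
    and "a > 1" "b < 1" "j \<in> {1, -1}" "a' > 1" "b' < 1" "j' \<in> {1, -1}"
  shows "a' = a" "b' = b" "j' = j"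
proof -
  define \<tau> \<tau>' where "\<tau> = sqrt ((1 - b) / (a - 1))" and "\<tau>' = sqrt ((1 - b') / (a' - 1))"
  have \<tau>: "\<tau> > 0" "\<tau>' > 0" using assms by (simp_all add: \<tau>_def \<tau>'_def)
  have ab: "a > b" "a' > b'" using assms by linarith+
  define v where "v = arc a b j \<tau>"
  have eq: "tangent_act (map_matrix real_of_int A) v = arc a' b' j' \<tau>'"
    using assms(2) by (simp add: v_def section_vec_def \<tau>_def \<tau>'_def)
  have Re: "Re (fst v) = of_int j" "Re (fst (arc a' b' j' \<tau>')) = of_int j'"
    unfolding v_def using Re_arc_eq_iff assms \<tau> by (simp_all add: \<tau>_def \<tau>'_def)
  have "v \<in> T1H" unfolding v_def using ab(1) \<tau>(1) assms(5) by (rule arc_T1H)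
  then have Im: "Im (fst v) > 0" by (auto simp: T1H_def)
  have odd: "odd j" "odd j'" using assms by auto
  have "Re (fst (tangent_act (map_matrix real_of_int A) v)) = of_int j'" using eq Re by simp
  note Re' = this[unfolded fst_tangent_act_Theta]
  have c: "A$2$1 = 0" using odd_line_stabilizer[OF assms(1) odd(2,1) Im Re(1) Re'] .
  then have "A$1$1 * A$2$2 = 1" using assms(1) by (simp add: Theta_iff)
  then obtain e where e: "e \<in> {1, -1}" "A$1$1 = e" "A$2$2 = e" by (auto simp: zmult_eq_1_iff)
  define m where "m = e * A$1$2"
  have m: "A$1$2 = e * m" using e by (auto simp: m_def)
  have "fst v + of_int m = (of_int (A$1$1) * fst v + of_int (A$1$2)) / (of_int (A$2$1) * fst v + of_int (A$2$2))"
    using c e m by auto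
  then have jm: "real_of_int j + of_int m = of_int j'" using Re' Re(1) by (metis plus_complex.sel(1) Re_complex_of_real of_real_of_int_eq)
  have "frame (a * \<tau> + of_int m * (of_int j * \<tau>)) (of_int j * b + of_int m) (of_int j * \<tau>) 1
      = arc a' b' j' \<tau>'"
  proof -
    have "arc a' b' j' \<tau>' = frame (of_int e * (a * \<tau> + of_int m * (of_int j * \<tau>)))
      (of_int e * (of_int j * b + of_int m)) (of_int e * (of_int j * \<tau>)) (of_int e * 1)"
      unfolding eq[symmetric] v_def tangent_act_Theta_arc[OF assms(1) ab(1) \<tau>(1) assms(5)]
      by (simp add: c e m algebra_simps)
    then show ?thesis using e(1) frame_scale[of "of_int e"] by (metis insert_iff of_int_0_eq_iff singletonD zero_neq_neg_one zero_neq_one)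
  qed
  moreover have "(a * \<tau> + of_int m * (of_int j * \<tau>)) * 1 - (of_int j * b + of_int m) * (of_int j * \<tau>) > 0"
    using arc_det[OF ab(1) \<tau>(1) assms(5)] by (simp add: algebra_simps)
  ultimately have "of_int j' * a' = (a * \<tau> + of_int m * (of_int j * \<tau>)) / (of_int j * \<tau>)"
    "of_int j' * b' = of_int j * b + of_int m"
    using arc_ends(1,2)[OF ab(2) \<tau>(2) assms(8)] has_forward_end_frame has_backward_end_frame
    by (metis div_by_1)+
  then have ends: "of_int j' * a' = of_int j * a + of_int m" "of_int j' * b' = of_int j * b + of_int m"
    using \<tau> assms(5) by (auto simp: field_simps)
  show "j' = j"
  proof (rule ccontr)
    assume "j' \<noteq> j"
    then have "real_of_int j' = - of_int j" "real_of_int m = - 2 * of_int j" using assms jm by auto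
    then show False using ends(1) assms by auto
  qed
  then show "a' = a" "b' = b" using ends jm assms by auto
qed

text \<open>A crossing with \<open>b\<close> out of range might still be equivalent to some vector
  of \<open>X\<close>; \<open>section_unique\<close> excludes this.\<close>

lemma proj_section_mem_iff:
  assumes "a > 1" "b < 1" "j \<in> {1, -1}"
  shows "proj (section_vec a b j) \<in> proj ` X \<longleftrightarrow> - sqrt 3 \<le> b \<and> b < 2 - sqrt 3"
proof
  assume "proj (section_vec a b j) \<in> proj ` X"
  then obtain A where A: "A \<in> Theta" "tangent_act (map_matrix real_of_int A) (section_vec a b j) \<in> X"
    using proj_mem_image_iff[OF section_vec_T1H[OF assms] X_subset_T1H] by blast
  then obtain a' b' j' where *: "a' > 1" "- sqrt 3 \<le> b'" "b' < 2 - sqrt 3" "j' \<in> {1, -1}"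
      "tangent_act (map_matrix real_of_int A) (section_vec a b j) = section_vec a' b' j'"
    unfolding mem_X_iff by blast
  moreover have "b' < 1" using * sqrt3_bounds by linarith
  ultimately have "b' = b" using section_unique[OF A(1) *(5)] assms by blast
  then show "- sqrt 3 \<le> b \<and> b < 2 - sqrt 3" using * by simp
next
  assume "- sqrt 3 \<le> b \<and> b < 2 - sqrt 3"
  then show "proj (section_vec a b j) \<in> proj ` X" using assms mem_X_iff by blast
qed

section \<open>Passage to the next crossing\<close>

text \<open>Unlike for a return, \<open>u'\<close> need not lie in the section. This lets moves be
  chained through crossings outside it.\<close>

definition first_hit :: "tvec set \<Rightarrow> tvec set \<Rightarrow> bool" where
  "first_hit u u' \<longleftrightarrow> (\<exists>t>0. quotient_flow t u = u' \<and>
     (\<forall>s. 0 < s \<and> s < t \<longrightarrow> quotient_flow s u \<notin> proj ` X))"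

lemma first_hit_trans:
  assumes "first_hit (proj v) (proj w)" "first_hit (proj w) u" "proj w \<notin> proj ` X" "v \<in> T1H"
  shows "first_hit (proj v) u"
proof -
  obtain t where t: "t > 0" "quotient_flow t (proj v) = proj w"
      "\<And>s. 0 < s \<Longrightarrow> s < t \<Longrightarrow> quotient_flow s (proj v) \<notin> proj ` X"
    using assms(1) by (auto simp: first_hit_def)
  obtain t' where t': "t' > 0" "quotient_flow t' (proj w) = u"
      "\<And>s. 0 < s \<Longrightarrow> s < t' \<Longrightarrow> quotient_flow s (proj w) \<notin> proj ` X"
    using assms(2) by (auto simp: first_hit_def)
  have add: "quotient_flow s (proj w) = quotient_flow (s + t) (proj v)" for s
    unfolding t(2)[symmetric] using assms(4)
    by (simp add: quotient_flow_proj geodesic_flow_T1H geodesic_flow_add)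
  have "quotient_flow s (proj v) \<notin> proj ` X" if "0 < s" "s < t' + t" for s
  proof -
    consider "s < t" | "s = t" | "s > t" by linarith
    then show ?thesis
    proof cases
      case 3
      then have "quotient_flow (s - t) (proj w) \<notin> proj ` X" using t'(3) that by simp
      then show ?thesis by (simp add: add)
    qed (use t assms(3) that in auto)
  qed
  then show ?thesis
    unfolding first_hit_def using t(1) t'(1,2) add[of t'] by (metis add_pos_pos)
qed

lemma first_hit_arc:
  assumes "a > b" "0 < \<tau>" "\<tau> < \<tau>'" "j \<in> {1, -1}"
    and "\<And>\<sigma>. \<tau> < \<sigma> \<Longrightarrow> \<sigma> < \<tau>' \<Longrightarrow> proj (arc a b j \<sigma>) \<notin> proj ` X"
  shows "first_hit (proj (arc a b j \<tau>)) (proj (arc a b j \<tau>'))"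
proof -
  have flow: "quotient_flow t (proj (arc a b j \<tau>)) = proj (arc a b j (exp t * \<tau>))" for t
    using assms arc_T1H by (simp add: quotient_flow_proj geodesic_flow_arc)
  define T where "T = ln (\<tau>' / \<tau>)"
  have T: "T > 0" "exp T * \<tau> = \<tau>'" using assms by (simp_all add: T_def)
  have "quotient_flow s (proj (arc a b j \<tau>)) \<notin> proj ` X" if "0 < s" "s < T" for s
  proof -
    have "exp s * \<tau> < exp T * \<tau>" "1 * \<tau> < exp s * \<tau>"
      using that assms(2) by (simp_all only: mult_less_cancel_right_pos exp_less_cancel_iff one_less_exp_iff)
    then show ?thesis unfolding flow using assms(5) T by simp
  qed
  then show ?thesis unfolding first_hit_def using flow T by metis
qed

text \<open>All three moves share the translation by \<open>-2 j\<close>, which takes the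
  quadrilateral just entered to the one of \<open>proj_arc_notin_X\<close>. Parameters are compared
  through their squares because those are rational in \<open>a\<close> and \<open>b\<close> at every
  crossing.\<close>

lemma first_hit_section:
  assumes "a > 1" "b < 1" "j \<in> {1, -1}" "0 < \<tau>'"
    and lt: "(1 - b) / (a - 1) < \<tau>'\<^sup>2"
    and target: "proj (arc (a - 2) (b - 2) j \<tau>') = u"
    and between: "\<And>\<sigma>. 0 < \<sigma> \<Longrightarrow> (1 - b) / (a - 1) < \<sigma>\<^sup>2 \<Longrightarrow> \<sigma>\<^sup>2 < \<tau>'\<^sup>2 \<Longrightarrow>
      proj (arc (a - 2) (b - 2) j \<sigma>) \<notin> proj ` X"
  shows "first_hit (proj (section_vec a b j)) u"
proof -
  define \<tau> where "\<tau> = sqrt ((1 - b) / (a - 1))"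
  have \<tau>: "\<tau> > 0" "\<tau>\<^sup>2 = (1 - b) / (a - 1)" using assms by (simp_all add: \<tau>_def)
  have "\<tau> < \<tau>'" using lt assms(4) unfolding \<tau>(2)[symmetric] by (simp add: power2_less_imp_less)
  have ab: "a > b" using assms by linarith
  have "first_hit (proj (arc a b j \<tau>)) (proj (arc a b j \<tau>'))"
  proof (rule first_hit_arc[OF ab \<tau>(1) \<open>\<tau> < \<tau>'\<close> assms(3)])
    fix \<sigma> assume \<sigma>: "\<tau> < \<sigma>" "\<sigma> < \<tau>'"
    then have "\<tau>\<^sup>2 < \<sigma>\<^sup>2" "\<sigma>\<^sup>2 < \<tau>'\<^sup>2" "0 < \<sigma>"
      using \<tau>(1) by (auto intro: power_strict_mono)
    then show "proj (arc a b j \<sigma>) \<notin> proj ` X"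
      using between \<tau>(2) by (simp add: proj_arc_translate[OF ab _ assms(3)])
  qed
  then show ?thesis
    using target proj_arc_translate[OF ab assms(4,3)] by (simp add: section_vec_def \<tau>_def)
qed

lemma step_translate:
  assumes "a > 3" "b < 1" "j \<in> {1, -1}"
  shows "first_hit (proj (section_vec a b j)) (proj (section_vec (a - 2) (b - 2) j))"
proof (rule first_hit_section)
  define \<tau>' where "\<tau>' = sqrt ((1 - (b - 2)) / ((a - 2) - 1))"
  have \<tau>'2: "\<tau>'\<^sup>2 = (3 - b) / (a - 3)" using assms by (simp add: \<tau>'_def)
  show "a > 1" "b < 1" "j \<in> {1, -1}" "0 < \<tau>'" using assms by (simp_all add: \<tau>'_def)
  show "(1 - b) / (a - 1) < \<tau>'\<^sup>2"
    unfolding \<tau>'2 using assms by (simp add: divide_less_eq less_divide_eq field_simps)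
  show "proj (arc (a - 2) (b - 2) j \<tau>') = proj (section_vec (a - 2) (b - 2) j)"
    by (simp add: section_vec_def \<tau>'_def)
  fix \<sigma> :: real assume \<sigma>: "0 < \<sigma>" "(1 - b) / (a - 1) < \<sigma>\<^sup>2" "\<sigma>\<^sup>2 < \<tau>'\<^sup>2"
  have 1: "(1 - b) < (a - 1) * \<sigma>\<^sup>2" and 2: "(a - 3) * \<sigma>\<^sup>2 < 3 - b"
    using \<sigma> assms unfolding \<tau>'2 by (simp_all add: field_simps)
  show "proj (arc (a - 2) (b - 2) j \<sigma>) \<notin> proj ` X"
  proof (rule proj_arc_notin_X)
    show "\<bar>(a - 2) * \<sigma>\<^sup>2 + (b - 2)\<bar> < \<sigma>\<^sup>2 + 1"
      using 1 2 by (simp add: abs_less_iff algebra_simps)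
    \<comment> \<open>Both ends lie outside [-1, 1], so the arc stays above the two lower sides.
      These products are the terms of the difference and of the sum of the two sides of the
      inequality.\<close>
    have "(a - 2) * (a - 3) * \<sigma>\<^sup>2 > 0" "(a - 2) * (a - 1) * \<sigma>\<^sup>2 > 0" "(b - 2) * (b - 3) > 0" "(b - 2) * (b - 1) > 0"
      using assms \<sigma> by (auto intro!: mult_pos_pos mult_neg_neg)
    then show "\<bar>(a - 2) * \<sigma>\<^sup>2 + (b - 2)\<bar> < (a - 2)\<^sup>2 * \<sigma>\<^sup>2 + (b - 2)\<^sup>2"
      by (simp add: abs_less_iff power2_eq_square algebra_simps)
  qed (use assms \<sigma> in auto)
qed

lemma step_invert_opposite:
  assumes "2 < a" "a < 3" "b < 1" "j \<in> {1, -1}"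
  shows "first_hit (proj (section_vec a b j)) (proj (section_vec (1 / (a - 2)) (1 / (b - 2)) (- j)))"
proof -
  define \<alpha> \<beta> where "\<alpha> = a - 2" and "\<beta> = b - 2"
  have \<alpha>: "0 < \<alpha>" "\<alpha> < 1" and \<beta>: "\<beta> < -1" using assms by (simp_all add: \<alpha>_def \<beta>_def)
  \<comment> \<open>Chosen so that \<open>- \<alpha> * \<tau>' / \<beta>\<close>, the parameter
    after the inversion, is the one in \<open>section_vec\<close>. At \<open>\<tau>'\<close> the arc
    meets the semicircle with ends 0 and \<open>j\<close>.\<close>
  define \<tau>' where "\<tau>' = (- \<beta> / \<alpha>) * sqrt ((1 - 1 / \<beta>) / (1 / \<alpha> - 1))"
  have \<beta>1: "1 - 1 / \<beta> > 0" and \<alpha>1: "1 / \<alpha> - 1 > 0" using \<alpha> \<beta> by (simp_all add: field_simps)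
  have \<tau>'0: "\<tau>' > 0" unfolding \<tau>'_def using \<alpha> \<beta> \<alpha>1 \<beta>1 by (intro mult_pos_pos divide_pos_pos real_sqrt_gt_zero) auto
  have "\<tau>'\<^sup>2 = (- \<beta> / \<alpha>)\<^sup>2 * ((1 - 1 / \<beta>) / (1 / \<alpha> - 1))"
    unfolding \<tau>'_def power_mult_distrib using \<alpha>1 \<beta>1 by simp
  also have "\<dots> = \<beta> * (\<beta> - 1) / (\<alpha> * (1 - \<alpha>))"
    using \<alpha> \<beta> \<alpha>1 by (simp add: field_simps power2_eq_square)
  finally have \<tau>'2: "\<tau>'\<^sup>2 = \<beta> * (\<beta> - 1) / (\<alpha> * (1 - \<alpha>))" .
  have ab: "1 - b = - (\<beta> + 1)" "a - 1 = \<alpha> + 1" by (simp_all add: \<alpha>_def \<beta>_def)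
  show ?thesis
  proof (rule first_hit_section, unfold ab \<alpha>_def[symmetric] \<beta>_def[symmetric])
    show "a > 1" "b < 1" "j \<in> {1, -1}" "0 < \<tau>'" using assms \<tau>'0 by auto
    have pos: "\<alpha> * (1 - \<alpha>) > 0" using \<alpha> by simp
    \<comment> \<open>The cross-multiplied difference of exit and entry parameters, factored;
      \<open>\<alpha> - \<beta>\<close> equals \<open>a - b\<close>.\<close>
    have "0 < (\<alpha> - \<beta>) * (- (\<beta> + 1) * \<alpha> + (1 - \<beta>))"
      using \<alpha> \<beta> by (intro mult_pos_pos add_pos_pos) auto
    then have "- (\<beta> + 1) * (\<alpha> * (1 - \<alpha>)) < \<beta> * (\<beta> - 1) * (\<alpha> + 1)" by (simp add: algebra_simps)
    then show "- (\<beta> + 1) / (\<alpha> + 1) < \<tau>'\<^sup>2"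
      unfolding \<tau>'2 using \<alpha> pos by (simp only: divide_less_eq less_divide_eq) (simp add: field_simps)
    have "- \<alpha> * \<tau>' / \<beta> = sqrt ((1 - 1 / \<beta>) / (1 / \<alpha> - 1))"
      using \<alpha> \<beta> by (simp add: \<tau>'_def)
    then show "proj (arc \<alpha> \<beta> j \<tau>') = proj (section_vec (1 / \<alpha>) (1 / \<beta>) (- j))"
      using proj_arc_invert_opposite[of \<alpha> \<beta> \<tau>' j] \<alpha> \<beta> assms(4) \<tau>'0 by (simp add: section_vec_def)
    fix \<sigma> :: real assume \<sigma>: "0 < \<sigma>" "- (\<beta> + 1) / (\<alpha> + 1) < \<sigma>\<^sup>2" "\<sigma>\<^sup>2 < \<tau>'\<^sup>2"
    have 1: "- (\<beta> + 1) < (\<alpha> + 1) * \<sigma>\<^sup>2" using \<sigma>(2) \<alpha> by (simp add: field_simps)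
    have 2: "\<alpha> * (1 - \<alpha>) * \<sigma>\<^sup>2 < \<beta> * (\<beta> - 1)"
      using \<sigma>(3) pos unfolding \<tau>'2 by (simp add: less_divide_eq mult_ac)
    show "proj (arc \<alpha> \<beta> j \<sigma>) \<notin> proj ` X"
    proof (rule proj_arc_notin_X)
      have "\<alpha> * \<sigma>\<^sup>2 \<le> 1 * \<sigma>\<^sup>2" using \<alpha> by (intro mult_right_mono) auto
      then show "\<bar>\<alpha> * \<sigma>\<^sup>2 + \<beta>\<bar> < \<sigma>\<^sup>2 + 1"
        using 1 \<beta> by (simp add: abs_less_iff algebra_simps)
      \<comment> \<open>The lower side with ends 0 and \<open>-j\<close> is avoided because of the
        positions of the endpoints; the other one, through which the arc leaves, is avoided before
        \<open>\<tau>'\<close> by 2.\<close>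
      have "\<alpha> * (\<alpha> + 1) * \<sigma>\<^sup>2 > 0" "\<beta> * (\<beta> + 1) > 0"
        using \<alpha> \<beta> \<sigma> by (auto intro!: mult_pos_pos mult_neg_neg)
      then show "\<bar>\<alpha> * \<sigma>\<^sup>2 + \<beta>\<bar> < \<alpha>\<^sup>2 * \<sigma>\<^sup>2 + \<beta>\<^sup>2"
        using 2 by (simp add: abs_less_iff power2_eq_square algebra_simps)
    qed (use assms \<alpha> \<beta> \<sigma> in auto)
  qed
qed

lemma step_invert_same:
  assumes "1 < a" "a < 2" "b < 1" "j \<in> {1, -1}"
  shows "first_hit (proj (section_vec a b j)) (proj (section_vec (1 / (2 - a)) (1 / (2 - b)) j))"
proof -
  define \<alpha> \<beta> where "\<alpha> = a - 2" and "\<beta> = b - 2"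
  have \<alpha>: "-1 < \<alpha>" "\<alpha> < 0" and \<beta>: "\<beta> < -1" using assms by (simp_all add: \<alpha>_def \<beta>_def)
  \<comment> \<open>Now the arc leaves through the semicircle with ends 0 and \<open>-j\<close>,
    which \<open>-1/z\<close> sends to the line over \<open>j\<close>.\<close>
  define \<tau>' where "\<tau>' = (\<beta> / \<alpha>) * sqrt ((1 - - 1 / \<beta>) / (- 1 / \<alpha> - 1))"
  have \<beta>1: "1 - - 1 / \<beta> > 0" and \<alpha>1: "- 1 / \<alpha> - 1 > 0" using \<alpha> \<beta> by (simp_all add: field_simps)
  have \<tau>'0: "\<tau>' > 0" unfolding \<tau>'_def using \<alpha> \<beta> \<alpha>1 \<beta>1
    by (intro mult_pos_pos divide_neg_neg divide_pos_pos real_sqrt_gt_zero) auto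
  have "\<tau>'\<^sup>2 = (\<beta> / \<alpha>)\<^sup>2 * ((1 - - 1 / \<beta>) / (- 1 / \<alpha> - 1))"
    unfolding \<tau>'_def power_mult_distrib using \<alpha>1 \<beta>1 by simp
  also have "\<dots> = \<beta> * (\<beta> + 1) / (- \<alpha> * (1 + \<alpha>))"
  proof -
    have "1 - - 1 / \<beta> = (\<beta> + 1) / \<beta>" "- 1 / \<alpha> - 1 = (1 + \<alpha>) / (- \<alpha>)"
      using \<alpha> \<beta> by (simp_all add: field_simps)
    moreover have "(\<beta> / \<alpha>)\<^sup>2 * (B / \<beta> / (A / (- \<alpha>))) = \<beta> * B / (- \<alpha> * A)" if "A \<noteq> 0" for A B
      using \<alpha> \<beta> that by (simp add: power2_eq_square field_simps)
    ultimately show ?thesis using \<alpha> by simp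
  qed
  finally have \<tau>'2: "\<tau>'\<^sup>2 = \<beta> * (\<beta> + 1) / (- \<alpha> * (1 + \<alpha>))" .
  have ab: "1 - b = - (\<beta> + 1)" "a - 1 = \<alpha> + 1" by (simp_all add: \<alpha>_def \<beta>_def)
  have ab': "1 / (2 - a) = - 1 / \<alpha>" "1 / (2 - b) = - 1 / \<beta>"
    using minus_divide_divide[of 1 \<alpha>] minus_divide_divide[of 1 \<beta>] by (simp_all add: \<alpha>_def \<beta>_def)
  show ?thesis
  proof (rule first_hit_section, unfold ab' ab \<alpha>_def[symmetric] \<beta>_def[symmetric])
    show "a > 1" "b < 1" "j \<in> {1, -1}" "0 < \<tau>'" using assms \<tau>'0 by auto
    have pos: "- \<alpha> * (1 + \<alpha>) > 0" using \<alpha> by (intro mult_pos_pos) auto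
    have "0 < (\<alpha> - \<beta>) * (- (\<beta> + 1)) * (\<alpha> + 1)"
      using assms \<alpha> \<beta> by (intro mult_pos_pos) auto
    then have "- (\<beta> + 1) * (- \<alpha> * (1 + \<alpha>)) < \<beta> * (\<beta> + 1) * (\<alpha> + 1)" by (simp add: algebra_simps)
    then show "- (\<beta> + 1) / (\<alpha> + 1) < \<tau>'\<^sup>2"
      unfolding \<tau>'2 using \<alpha> pos by (simp only: divide_less_eq less_divide_eq) (simp add: field_simps)
    have "\<alpha> * \<tau>' / \<beta> = sqrt ((1 - - 1 / \<beta>) / (- 1 / \<alpha> - 1))"
      using \<alpha> \<beta> by (simp add: \<tau>'_def)
    then show "proj (arc \<alpha> \<beta> j \<tau>') = proj (section_vec (- 1 / \<alpha>) (- 1 / \<beta>) j)"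
      using proj_arc_invert_same[of \<beta> \<alpha> \<tau>' j] \<alpha> \<beta> assms(4) \<tau>'0 by (simp add: section_vec_def)
    fix \<sigma> :: real assume \<sigma>: "0 < \<sigma>" "- (\<beta> + 1) / (\<alpha> + 1) < \<sigma>\<^sup>2" "\<sigma>\<^sup>2 < \<tau>'\<^sup>2"
    have 1: "- (\<beta> + 1) < (\<alpha> + 1) * \<sigma>\<^sup>2" using \<sigma>(2) \<alpha> by (simp add: field_simps)
    have 2: "- \<alpha> * (1 + \<alpha>) * \<sigma>\<^sup>2 < \<beta> * (\<beta> + 1)"
      using \<sigma>(3) pos unfolding \<tau>'2 by (simp only: less_divide_eq mult_ac)
    show "proj (arc \<alpha> \<beta> j \<sigma>) \<notin> proj ` X"
    proof (rule proj_arc_notin_X)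
      have "\<alpha> * \<sigma>\<^sup>2 \<le> 1 * \<sigma>\<^sup>2" using \<alpha> by (intro mult_right_mono) auto
      then show "\<bar>\<alpha> * \<sigma>\<^sup>2 + \<beta>\<bar> < \<sigma>\<^sup>2 + 1"
        using 1 \<beta> by (simp add: abs_less_iff algebra_simps)
      have "- \<alpha> * (1 - \<alpha>) * \<sigma>\<^sup>2 > 0"
        by (intro mult_pos_pos) (use \<alpha> \<sigma> in auto)
      moreover have "\<beta> * (\<beta> - 1) > 0" using \<beta> by (auto intro!: mult_neg_neg)
      ultimately show "\<bar>\<alpha> * \<sigma>\<^sup>2 + \<beta>\<bar> < \<alpha>\<^sup>2 * \<sigma>\<^sup>2 + \<beta>\<^sup>2"
        using 2 by (simp add: abs_less_iff power2_eq_square algebra_simps)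
    qed (use assms \<alpha> \<beta> \<sigma> in \<open>auto simp: \<alpha>_def \<beta>_def\<close>)
  qed
qed

text \<open>Every crossing after the first has backward coordinate at most
  \<open>b - 2 < - sqrt 3\<close> and hence lies outside the section.\<close>

lemma first_hit_translates:
  assumes "first_hit (proj (section_vec (a - 2 * real n) (b - 2 * real n) j)) u"
    and "2 * real n + 1 < a" "b < 2 - sqrt 3" "j \<in> {1, -1}"
  shows "first_hit (proj (section_vec a b j)) u"
  using assms
proof (induction n)
  case (Suc n)
  let ?a = "a - 2 * real n" and ?b = "b - 2 * real n"
  have e: "a - 2 * real (Suc n) = ?a - 2" "b - 2 * real (Suc n) = ?b - 2" by simp_all
  have ab: "?a > 3" "?b < 1" "?b - 2 < - sqrt 3"
    using Suc.prems sqrt3_bounds by (simp_all, linarith)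
  have T: "section_vec ?a ?b j \<in> T1H" using ab Suc.prems(4) by (intro section_vec_T1H) auto
  have "proj (section_vec (?a - 2) (?b - 2) j) \<notin> proj ` X"
    using proj_section_mem_iff[of "?a - 2" "?b - 2" j] ab Suc.prems(4) by auto
  then have "first_hit (proj (section_vec ?a ?b j)) u"
    using first_hit_trans[OF step_translate[OF ab(1,2) Suc.prems(4)] _ _ T] Suc.prems(1)
    unfolding e by blast
  then show ?case using Suc by simp
qed simp

text \<open>For \<open>b = 1 + 1/q\<close> the right-hand side is \<open>1/(2 - b)\<close>. It
  increases with \<open>b\<close> and sends \<open>- sqrt 3\<close> to \<open>2 - sqrt 3\<close>, as
  \<open>(2 - sqrt 3)(2 + sqrt 3) = 1\<close>. So one such move leaves the section on its
  right.\<close>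

lemma inversion_step_bound:
  fixes q :: real
  assumes "q < 0" "- sqrt 3 \<le> 1 + 1 / q"
  shows "2 - sqrt 3 \<le> 1 + 1 / (q - 1)"
proof -
  have "(2 - sqrt 3) * (2 + sqrt 3) = 1" by (simp add: algebra_simps)
  moreover have "2 + sqrt 3 > 0" by (simp add: add_pos_nonneg)
  ultimately have "2 - sqrt 3 = 1 / (2 + sqrt 3)" by (simp add: eq_divide_eq)
  also have "\<dots> \<le> 1 / (2 - (1 + 1 / q))"
    using assms by (intro divide_left_mono mult_pos_pos) (auto simp: add_pos_nonneg add_pos_pos)
  also have "\<dots> = 1 + 1 / (q - 1)" using assms(1) by (simp add: field_simps)
  finally show ?thesis .
qed

text \<open>In the coordinate \<open>s = 1 / (a - 1)\<close> the substitution \<open>a \<mapsto> 1 / (2 - a)\<close> is \<open>s \<mapsto> s - 1\<close>.\<close>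

lemma first_hit_inversions:
  assumes "first_hit (proj (section_vec (1 + 1 / (s - real n)) (1 + 1 / (q - real n)) j)) u"
    and "real n < s" "q < 0" "- sqrt 3 \<le> 1 + 1 / q" "j \<in> {1, -1}"
  shows "first_hit (proj (section_vec (1 + 1 / s) (1 + 1 / q) j)) u"
  using assms
proof (induction n arbitrary: s q)
  case (Suc n)
  let ?a = "1 + 1 / s" and ?b = "1 + 1 / q"
  have s: "s > 1" using Suc.prems(2) by simp
  have q: "q < 0" "q - 1 < 0" using Suc.prems(3) by simp_all
  have e: "1 / (2 - ?a) = 1 + 1 / (s - 1)" "1 / (2 - ?b) = 1 + 1 / (q - 1)"
    using s q by (simp_all add: field_simps)
  have ab: "1 < ?a" "?a < 2" "?b < 1" using s q by (simp_all add: field_simps)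
  have T: "section_vec ?a ?b j \<in> T1H" using ab Suc.prems(5) by (intro section_vec_T1H) auto
  have b': "2 - sqrt 3 \<le> 1 + 1 / (q - 1)" using inversion_step_bound Suc.prems(3,4) .
  have "first_hit (proj (section_vec (1 + 1 / (s - 1)) (1 + 1 / (q - 1)) j)) u"
  proof (rule Suc.IH)
    have "s - real (Suc n) = s - 1 - real n" "q - real (Suc n) = q - 1 - real n" by simp_all
    then show "first_hit (proj (section_vec (1 + 1 / (s - 1 - real n)) (1 + 1 / (q - 1 - real n)) j)) u"
      using Suc.prems(1) by (simp only:)
    show "real n < s - 1" using Suc.prems(2) by simp
    \<comment> \<open>The lower bound is inherited, so the later crossings of the run stay outside
      the section as well.\<close>
    show "- sqrt 3 \<le> 1 + 1 / (q - 1)" using b' sqrt3_bounds by linarith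
  qed (rule q(2), rule Suc.prems(5))
  moreover have "proj (section_vec (1 + 1 / (s - 1)) (1 + 1 / (q - 1)) j) \<notin> proj ` X"
  proof -
    have "1 + 1 / (s - 1) > 1" "1 + 1 / (q - 1) < 1" using s q by simp_all
    then show ?thesis using proj_section_mem_iff Suc.prems(5) b' by (meson not_le)
  qed
  ultimately show ?case
    using first_hit_trans[OF step_invert_same[OF ab Suc.prems(5)] _ _ T] unfolding e by blast
qed simp

section \<open>Symbols\<close>

text \<open>Each symbol gets an integer code such that its cell lies between the code and its
  successor, in the coordinate \<open>a\<close> for even cells and \<open>2/(a - 1)\<close> for odd
  ones. The bounds are non-strict because the cells differ in which ends they contain.\<close>

lemma cell_code:
  assumes "(k, \<epsilon>, s) \<in> alphabet" "a > 1" "1 / a \<in> cell (k, \<epsilon>, s)"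
  shows "s = Ev \<Longrightarrow> a \<ge> 2 \<and> of_int (if \<epsilon> = 1 then 2 * int k else 2 * int k - 1) \<le> a
      \<and> a \<le> of_int (if \<epsilon> = 1 then 2 * int k else 2 * int k - 1) + 1"
    and "s = Od \<Longrightarrow> a \<le> 2 \<and> of_int (if \<epsilon> = 1 then 2 * int k - 1 else 2 * int k - 2) \<le> 2 / (a - 1)
      \<and> 2 / (a - 1) \<le> of_int (if \<epsilon> = 1 then 2 * int k - 1 else 2 * int k - 2) + 1"
proof -
  have a: "a > 0" "a - 1 > 0" using assms(2) by auto
  have cases: "\<epsilon> = 1 \<and> k = 1 \<and> s = Ev \<or> \<epsilon> = 1 \<and> k \<ge> 2 \<or> \<epsilon> = -1 \<and> k \<ge> 2"
    using assms(1) by (auto simp: alphabet_def)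
  show "a \<ge> 2 \<and> of_int (if \<epsilon> = 1 then 2 * int k else 2 * int k - 1) \<le> a
      \<and> a \<le> of_int (if \<epsilon> = 1 then 2 * int k else 2 * int k - 1) + 1" if s: "s = Ev"
  proof -
    have k2: "k \<ge> 2 \<Longrightarrow> real k \<ge> 2" by simp
    from cases consider "\<epsilon> = 1" "k = 1" | "\<epsilon> = 1" "k \<ge> 2" | "\<epsilon> = -1" "k \<ge> 2" by blast
    then show ?thesis
    proof cases
      case 1
      then show ?thesis using assms(3) s a by (simp add: field_simps)
    next
      case 2
      then have "1 / (2 * real k + 1) \<le> 1 / a" "1 / a < 1 / (2 * real k)"
        using assms(3) s by auto
      then have "a \<le> 2 * real k + 1" "2 * real k < a"
        using a 2 by (simp_all add: field_simps)
      then show ?thesis using 2 k2 by simp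
    next
      case 3
      then have "1 / (2 * real k) \<le> 1 / a" "1 / a < 1 / (2 * real k - 1)"
        using assms(3) s by auto
      then have "a \<le> 2 * real k" "2 * real k - 1 < a"
        using a 3 k2 by (simp_all add: field_simps)
      then show ?thesis using 3 k2 by simp
    qed
  qed
  show "a \<le> 2 \<and> of_int (if \<epsilon> = 1 then 2 * int k - 1 else 2 * int k - 2) \<le> 2 / (a - 1)
      \<and> 2 / (a - 1) \<le> of_int (if \<epsilon> = 1 then 2 * int k - 1 else 2 * int k - 2) + 1" if s: "s = Od"
  proof -
    define d where "d = a - 1"
    have d: "d > 0" "a = 1 + d" using a by (simp_all add: d_def)
    from cases s have k: "real k \<ge> 2" by auto
    then have dk: "2 * d \<le> k * d" using d by (intro mult_right_mono) auto
    from cases s consider "\<epsilon> = 1" | "\<epsilon> = -1" by blast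
    then show ?thesis
    proof cases
      case 1
      then have "(2 * real k - 1) / (2 * real k + 1) < 1 / a" "1 / a \<le> real k / (real k + 1)"
        using assms(3) s by auto
      then have *: "(2 * real k - 1) * d < 2" "1 \<le> real k * d"
        using a k by (simp_all add: d field_simps)
      moreover have "2 * d \<le> (2 * real k - 1) * d" using d k by (intro mult_right_mono) auto
      ultimately have "d < 1" by linarith
      with * show ?thesis
        unfolding d_def[symmetric] using 1 d by (simp add: field_simps)
    next
      case 2
      then have "(real k - 1) / real k < 1 / a" "1 / a \<le> (2 * real k - 1) / (2 * real k + 1)"
        using assms(3) s by auto
      then have *: "(real k - 1) * d < 1" "2 \<le> (2 * real k - 1) * d"
        using a k by (simp_all add: d field_simps)
      moreover have "1 * d \<le> (real k - 1) * d" using d k by (intro mult_right_mono) auto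
      ultimately have "d < 1" by linarith
      with * show ?thesis
        unfolding d_def[symmetric] using 2 d by (simp add: field_simps)
    qed
  qed
qed

text \<open>The parity of the code recovers the sign, and then \<open>k\<close>.\<close>

lemma symbol_eqI:
  assumes "(k, \<epsilon>, s) \<in> alphabet" "(k', \<epsilon>', s) \<in> alphabet"
    and "(if \<epsilon> = 1 then 2 * int k else 2 * int k - 1) = (if \<epsilon>' = 1 then 2 * int k' else 2 * int k' - 1)"
  shows "(k', \<epsilon>') = (k, \<epsilon>)"
proof -
  have "\<epsilon> \<in> {1, -1}" "\<epsilon>' \<in> {1, -1}" using assms by (auto simp: alphabet_def)
  then show ?thesis using assms(3) by auto presburger+
qed

lemma first_symbol_Ev:
  assumes \<sigma>: "(k, \<epsilon>, Ev) \<in> alphabet"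
    and a: "of_int (if \<epsilon> = 1 then 2 * int k else 2 * int k - 1) < a"
      "a < of_int (if \<epsilon> = 1 then 2 * int k else 2 * int k - 1) + 1"
  shows "first_symbol (1 / a) = (k, \<epsilon>, Ev)"
  unfolding first_symbol_def
proof (rule the_equality)
  have \<epsilon>: "\<epsilon> = 1 \<or> \<epsilon> = -1 \<and> k \<ge> 2" and k: "real k \<ge> 1" using \<sigma> by (auto simp: alphabet_def)
  have a2: "a > 2" using a k \<epsilon> by auto
  have "1 / a \<in> cell (k, \<epsilon>, Ev)"
  proof (cases "\<epsilon> = 1")
    case True
    then have "1 / (2 * real k + 1) < 1 / a" "1 / a < 1 / (2 * real k)"
      using a a2 k by (simp_all add: field_simps)
    then show ?thesis using True a a2 by (cases "k = 1") (simp_all add: field_simps)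
  next
    case False
    then have "1 / (2 * real k) < 1 / a" "1 / a < 1 / (2 * real k - 1)"
      using a a2 k by (simp_all add: field_simps)
    then show ?thesis using False by simp
  qed
  then show "(k, \<epsilon>, Ev) \<in> alphabet \<and> 1 / a \<in> cell (k, \<epsilon>, Ev)" using \<sigma> by blast
  fix \<sigma>' assume "\<sigma>' \<in> alphabet \<and> 1 / a \<in> cell \<sigma>'"
  moreover obtain k' \<epsilon>' s' where \<sigma>': "\<sigma>' = (k', \<epsilon>', s')" by (cases \<sigma>') auto
  ultimately have *: "(k', \<epsilon>', s') \<in> alphabet" "1 / a \<in> cell (k', \<epsilon>', s')" by auto
  have "a > 1" using a2 by simp
  note code = cell_code[OF *(1) this *(2)]
  have s': "s' = Ev" using code(2) a2 by (cases s') auto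
  define n n' where "n = (if \<epsilon> = 1 then 2 * int k else 2 * int k - 1)"
    and "n' = (if \<epsilon>' = 1 then 2 * int k' else 2 * int k' - 1)"
  have "of_int n < a" "a < of_int n + 1" "of_int n' \<le> a" "a \<le> of_int n' + 1"
    using a code(1)[OF s'] unfolding n_def n'_def by auto
  \<comment> \<open>Strict bounds for \<open>n\<close> and non-strict bounds for \<open>n'\<close>
    around the same number leave only one integer.\<close>
  then have "n = n'" by linarith
  then show "\<sigma>' = (k, \<epsilon>, Ev)"
    using symbol_eqI[OF \<sigma> *(1)[unfolded s']] s' \<sigma>' by (simp add: n_def n'_def)
qed

lemma first_symbol_Od:
  assumes \<sigma>: "(k, \<epsilon>, Od) \<in> alphabet" and a1: "a > 1"
    and a: "of_int (if \<epsilon> = 1 then 2 * int k - 1 else 2 * int k - 2) < 2 / (a - 1)"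
      "2 / (a - 1) < of_int (if \<epsilon> = 1 then 2 * int k - 1 else 2 * int k - 2) + 1"
  shows "first_symbol (1 / a) = (k, \<epsilon>, Od)"
  unfolding first_symbol_def
proof (rule the_equality)
  have \<epsilon>: "\<epsilon> = 1 \<or> \<epsilon> = -1" and k: "real k \<ge> 2" using \<sigma> by (auto simp: alphabet_def)
  define d where "d = a - 1"
  have d: "d > 0" "a = 1 + d" using a1 by (simp_all add: d_def)
  have "2 < 2 / (a - 1)" using a(1) k \<epsilon> by auto
  then have a2: "a < 2" using a1 by (simp add: field_simps)
  have "1 / a \<in> cell (k, \<epsilon>, Od)"
  proof (cases "\<epsilon> = 1")
    case True
    then have "(2 * real k - 1) * d < 2" "1 < real k * d"
      using a d k unfolding d_def[symmetric] by (simp_all add: field_simps)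
    then have "(2 * real k - 1) / (2 * real k + 1) < 1 / a" "1 / a < real k / (real k + 1)"
      using d k by (simp_all add: field_simps)
    then show ?thesis using True by simp
  next
    case False
    then have "(real k - 1) * d < 1" "2 < (2 * real k - 1) * d"
      using a d k \<epsilon> unfolding d_def[symmetric] by (simp_all add: field_simps)
    then have "(real k - 1) / real k < 1 / a" "1 / a < (2 * real k - 1) / (2 * real k + 1)"
      using d k by (simp_all add: field_simps)
    then show ?thesis using False by simp
  qed
  then show "(k, \<epsilon>, Od) \<in> alphabet \<and> 1 / a \<in> cell (k, \<epsilon>, Od)" using \<sigma> by blast
  fix \<sigma>' assume "\<sigma>' \<in> alphabet \<and> 1 / a \<in> cell \<sigma>'"
  moreover obtain k' \<epsilon>' s' where \<sigma>': "\<sigma>' = (k', \<epsilon>', s')" by (cases \<sigma>') auto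
  ultimately have *: "(k', \<epsilon>', s') \<in> alphabet" "1 / a \<in> cell (k', \<epsilon>', s')" by auto
  note code = cell_code[OF *(1) a1 *(2)]
  have s': "s' = Od" using code(1) a2 by (cases s') auto
  define n n' where "n = (if \<epsilon> = 1 then 2 * int k - 1 else 2 * int k - 2)"
    and "n' = (if \<epsilon>' = 1 then 2 * int k' - 1 else 2 * int k' - 2)"
  have "of_int n < 2 / (a - 1)" "2 / (a - 1) < of_int n + 1"
      "of_int n' \<le> 2 / (a - 1)" "2 / (a - 1) \<le> of_int n' + 1"
    using a code(2)[OF s'] unfolding n_def n'_def by auto
  then have "n = n'" by linarith
  \<comment> \<open>Odd codes are even codes lowered by 1, so \<open>symbol_eqI\<close> serves
    both.\<close>
  then have "(if \<epsilon> = 1 then 2 * int k else 2 * int k - 1) = (if \<epsilon>' = 1 then 2 * int k' else 2 * int k' - 1)"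
    by (simp add: n_def n'_def split: if_splits)
  then show "\<sigma>' = (k, \<epsilon>, Od)" using symbol_eqI[OF \<sigma> *(1)[unfolded s']] s' \<sigma>' by simp
qed

section \<open>Exceptional endpoints and boundaries of the cells\<close>

lemma nat_exceptional: "n \<ge> 2 \<Longrightarrow> real n \<in> exceptional"
  by (auto simp: exceptional_def intro!: bexI[of _ n])

text \<open>These are the \<open>a\<close> for which \<open>2/(a - 1)\<close> is an integer
  \<open>n\<close>: even \<open>n\<close> gives \<open>k/(k - 1)\<close>, odd
  \<open>n \<ge> 3\<close> gives \<open>(2k + 1)/(2k - 1)\<close>, and \<open>n = 1\<close> gives
  the integer 3.\<close>

lemma one_plus_two_div_exceptional:
  assumes "n \<ge> 1"
  shows "1 + 2 / real n \<in> exceptional"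
proof (cases "even n")
  case True
  then obtain m where m: "n = 2 * m" by blast
  then have "1 + 2 / real n = real (m + 1) / (real (m + 1) - 1)" using assms by (simp add: field_simps)
  moreover have "m + 1 \<ge> 2" using m assms by simp
  ultimately show ?thesis unfolding exceptional_def by blast
next
  case False
  then obtain m where m: "n = 2 * m + 1" using oddE by blast
  show ?thesis
  proof (cases "m = 0")
    case True
    then show ?thesis using nat_exceptional[of 3] m by simp
  next
    case False
    have "1 + 2 / real n = (2 * real (m + 1) + 1) / (2 * real (m + 1) - 1)"
      using m by (simp add: field_simps)
    moreover have "m + 1 \<ge> 2" using False by simp
    ultimately show ?thesis unfolding exceptional_def by blast
  qed
qed

lemma symbol_cases:
  assumes "a > 1" "a \<notin> exceptional"
  obtains (even_pos) k where "k \<ge> 1" "2 * real k < a" "a < 2 * real k + 1"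
    | (even_neg) k where "k \<ge> 2" "2 * real k - 1 < a" "a < 2 * real k"
    | (odd_pos) k where "k \<ge> 2" "2 * real k - 1 < 2 / (a - 1)" "2 / (a - 1) < 2 * real k"
    | (odd_neg) k where "k \<ge> 2" "2 * real k - 2 < 2 / (a - 1)" "2 / (a - 1) < 2 * real k - 1"
proof -
  consider "a < 2" | "a = 2" | "a > 2" by linarith
  then show ?thesis
  proof cases
    case 1
    define x where "x = 2 / (a - 1)"
    have x: "x > 2" using 1 assms(1) by (simp add: x_def field_simps)
    define n where "n = nat \<lfloor>x\<rfloor>"
    have n: "real n \<le> x" "x < real n + 1" "n \<ge> 2" using x by (simp_all add: n_def le_nat_floor)
    have "a = 1 + 2 / x" using assms(1) unfolding x_def by (simp add: field_simps)
    then have "real n \<noteq> x" using one_plus_two_div_exceptional[of n] n(3) assms(2) by auto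
    then have lt: "real n < x" using n by simp
    show ?thesis
    proof (cases "even n")
      case True
      then obtain m where "n = 2 * m" by blast
      \<comment> \<open>The code \<open>2 * m\<close> is \<open>2 * k - 2\<close> for
        \<open>k = m + 1\<close>.\<close>
      then show ?thesis using odd_neg[of "m + 1"] lt n by (simp add: x_def)
    next
      case False
      then obtain m where "n = 2 * m + 1" using oddE by blast
      then show ?thesis using odd_pos[of "m + 1"] lt n by (simp add: x_def)
    qed
  next
    case 2
    then show ?thesis using nat_exceptional[of 2] assms(2) by simp
  next
    case 3
    define n where "n = nat \<lfloor>a\<rfloor>"
    have n: "real n \<le> a" "a < real n + 1" "n \<ge> 2" using 3 by (simp_all add: n_def le_nat_floor)
    then have "real n \<noteq> a" using nat_exceptional[of n] assms(2) by auto
    then have lt: "real n < a" using n by simp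
    show ?thesis
    proof (cases "even n")
      case True
      then obtain m where "n = 2 * m" by blast
      then show ?thesis using even_pos[of m] lt n by simp
    next
      case False
      then obtain m where "n = 2 * m + 1" using oddE by blast
      then show ?thesis using even_neg[of "m + 1"] lt n by simp
    qed
  qed
qed

lemma frontier_half_open:
  fixes l u :: real
  assumes "l < u"
  shows "frontier {l..<u} = {l, u}" "frontier {l<..u} = {l, u}" "frontier {l..u} = {l, u}"
  using assms by (auto simp: frontier_def)

lemma frontier_cell:
  assumes "k \<ge> 2"
  shows "frontier (cell (1, 1, Ev)) = {1/3, 1/2}"
    and "frontier (cell (k, 1, Ev)) = {1 / (2 * real k + 1), 1 / (2 * real k)}"
    and "frontier (cell (k, -1, Ev)) = {1 / (2 * real k), 1 / (2 * real k - 1)}"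
    and "frontier (cell (k, 1, Od)) = {(2 * real k - 1) / (2 * real k + 1), real k / (real k + 1)}"
    and "frontier (cell (k, -1, Od)) = {(real k - 1) / real k, (2 * real k - 1) / (2 * real k + 1)}"
proof -
  have k: "real k \<ge> 2" using assms by simp
  have "1 / (2 * real k + 1) < 1 / (2 * real k)" "1 / (2 * real k) < 1 / (2 * real k - 1)"
    "(2 * real k - 1) / (2 * real k + 1) < real k / (real k + 1)"
    "(real k - 1) / real k < (2 * real k - 1) / (2 * real k + 1)"
    using k by (simp_all add: field_simps)
  then show "frontier (cell (1, 1, Ev)) = {1/3, 1/2}"
    "frontier (cell (k, 1, Ev)) = {1 / (2 * real k + 1), 1 / (2 * real k)}"
    "frontier (cell (k, -1, Ev)) = {1 / (2 * real k), 1 / (2 * real k - 1)}"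
    "frontier (cell (k, 1, Od)) = {(2 * real k - 1) / (2 * real k + 1), real k / (real k + 1)}"
    "frontier (cell (k, -1, Od)) = {(real k - 1) / real k, (2 * real k - 1) / (2 * real k + 1)}"
    using assms by (simp_all only: cell.simps frontier_half_open if_True if_False) (simp_all add: frontier_half_open)
qed

lemma frontier_cell_iff:
  "(\<exists>\<sigma>\<in>alphabet. x \<in> frontier (cell \<sigma>)) \<longleftrightarrow> (\<exists>e\<in>exceptional. x = 1 / e)"
proof
  assume "\<exists>\<sigma>\<in>alphabet. x \<in> frontier (cell \<sigma>)"
  then obtain k \<epsilon> s where \<sigma>: "(k, \<epsilon>, s) \<in> alphabet" "x \<in> frontier (cell (k, \<epsilon>, s))" by auto
  have n: "\<exists>e\<in>exceptional. x = 1 / e" if "x = 1 / real n" "n \<ge> 2" for n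
    using nat_exceptional that by blast
  have m: "\<exists>e\<in>exceptional. x = 1 / e" if "x = (real k - 1) / real k" "k \<ge> 2" for k
    using that by (intro bexI[of _ "real k / (real k - 1)"]) (auto simp: exceptional_def)
  have o: "\<exists>e\<in>exceptional. x = 1 / e" if "x = (2 * real k - 1) / (2 * real k + 1)" "k \<ge> 2" for k
    using that by (intro bexI[of _ "(2 * real k + 1) / (2 * real k - 1)"]) (auto simp: exceptional_def)
  consider "(k, \<epsilon>, s) = (1, 1, Ev)" | "k \<ge> 2" "(\<epsilon>, s) \<in> {(1, Ev), (-1, Ev), (1, Od), (-1, Od)}"
    using \<sigma>(1) by (auto simp: alphabet_def)
  then show "\<exists>e\<in>exceptional. x = 1 / e"
  proof cases
    case 1
    then have "x = 1 / real 3 \<or> x = 1 / real 2" using \<sigma>(2) frontier_cell(1)[of 2] by auto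
    then show ?thesis using n[of 3] n[of 2] by auto
  next
    case 2
    \<comment> \<open>The end \<open>k/(k + 1)\<close> is rewritten with \<open>k + 1\<close> in
      place of \<open>k\<close>, so that \<open>m\<close> applies to it.\<close>
    then have "x = 1 / real (2 * k + 1) \<or> x = 1 / real (2 * k) \<or> x = 1 / real (2 * k - 1) \<or>
        x = (2 * real k - 1) / (2 * real k + 1) \<or> x = (real (k + 1) - 1) / real (k + 1) \<or>
        x = (real k - 1) / real k"
      using \<sigma>(2) frontier_cell[OF 2(1)] by (auto simp: of_nat_diff add.commute)
    then show ?thesis
      using n[of "2 * k + 1"] n[of "2 * k"] n[of "2 * k - 1"] o[of k] m[of "k + 1"] m[of k] 2(1)
      by auto
  qed
next
  assume "\<exists>e\<in>exceptional. x = 1 / e"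
  then obtain k where k: "k \<ge> 2"
    and x: "x = (real k - 1) / real k \<or> x = (2 * real k - 1) / (2 * real k + 1) \<or> x = 1 / real k"
    by (auto simp: exceptional_def)
  have al: "(k, \<epsilon>, s) \<in> alphabet" if "\<epsilon> \<in> {1, -1}" "k \<ge> 2" for k \<epsilon> s
    using that by (cases s) (auto simp: alphabet_def)
  from x consider "x = (real k - 1) / real k \<or> x = (2 * real k - 1) / (2 * real k + 1)"
    | "x = 1 / real k" by blast
  then show "\<exists>\<sigma>\<in>alphabet. x \<in> frontier (cell \<sigma>)"
  proof cases
    case 1
    \<comment> \<open>The two points are the ends of one and the same cell, that of
      \<open>(k, -1, Od)\<close>.\<close>
    then show ?thesis using frontier_cell(5)[OF k] al[of "-1" k Od] k
      by (intro bexI[of _ "(k, -1, Od)"]) auto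
  next
    case 2
    \<comment> \<open>The numbers \<open>1/k\<close> occur in pairs as ends of the positive even
      cells; the pair 1/2, 1/3 belongs to the extra symbol \<open>(1, 1, Ev)\<close>.\<close>
    define m where "m = k div 2"
    have "k = 2 * m \<or> k = 2 * m + 1" unfolding m_def by presburger
    then have x: "x = 1 / (2 * real m + 1) \<or> x = 1 / (2 * real m)" using 2 by (auto simp: add.commute)
    have "m \<ge> 1" using k by (simp add: m_def)
    then consider "m = 1" | "m \<ge> 2" by linarith
    then show ?thesis
    proof cases
      case 1
      then show ?thesis using x frontier_cell(1)[of 2]
        by (intro bexI[of _ "(1, 1, Ev)"]) (auto simp: alphabet_def)
    next
      case 2
      then show ?thesis using x frontier_cell(2)[OF 2] al[of 1 m Ev]
        by (intro bexI[of _ "(m, 1, Ev)"]) auto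
    qed
  qed
qed

section \<open>The first return map\<close>

text \<open>An orbit meets \<open>X\<close> at most once; this makes the description in
  \<open>phi\<close> definite.\<close>

lemma proj_eq_imp_eq:
  assumes "v \<in> X" "w \<in> X" "proj v = proj w"
  shows "w = v"
proof -
  obtain a b j where v: "a > 1" "b < 2 - sqrt 3" "j \<in> {1, -1}" "v = section_vec a b j"
    using assms(1) unfolding mem_X_iff by blast
  obtain a' b' j' where w: "a' > 1" "b' < 2 - sqrt 3" "j' \<in> {1, -1}" "w = section_vec a' b' j'"
    using assms(2) unfolding mem_X_iff by blast
  have b: "b < 1" "b' < 1" using v w sqrt3_bounds by linarith+
  have "w \<in> proj v" using self_in_proj[of w] assms X_subset_T1H by (metis subsetD)
  then obtain A where "A \<in> Theta" "w = tangent_act (map_matrix real_of_int A) v"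
    by (auto simp: proj_def)
  then show ?thesis
    using section_unique[of A a b j a' b' j'] v w b by metis
qed

lemma phi_proj:
  assumes "v \<in> X"
  shows "phi (proj v) = geodesic_of v"
  unfolding phi_def
proof (rule the_equality)
  show "\<exists>w\<in>X. proj v = proj w \<and> geodesic_of v = geodesic_of w" using assms by blast
  fix \<gamma> assume "\<exists>w\<in>X. proj v = proj w \<and> \<gamma> = geodesic_of w"
  then show "\<gamma> = geodesic_of v" using proj_eq_imp_eq[OF assms] by blast
qed

lemma section_ends:
  assumes "a > 1" "b < 1" "j \<in> {1, -1}"
  shows "forward_end (geodesic_of (section_vec a b j)) = of_int j * a"
    and "backward_end (geodesic_of (section_vec a b j)) = of_int j * b"
    and "ends_in (geodesic_of (section_vec a b j)) S \<longleftrightarrow> (of_int j * a, of_int j * b) \<in> S"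
proof -
  have *: "b < a" "sqrt ((1 - b) / (a - 1)) > 0" using assms by auto
  show "forward_end (geodesic_of (section_vec a b j)) = of_int j * a"
    "backward_end (geodesic_of (section_vec a b j)) = of_int j * b"
    "ends_in (geodesic_of (section_vec a b j)) S \<longleftrightarrow> (of_int j * a, of_int j * b) \<in> S"
    unfolding section_vec_def by (rule arc_ends[OF * assms(3)])+
qed

lemma J_section:
  assumes "a > 1" "- sqrt 3 \<le> b" "b < 2 - sqrt 3" "j \<in> {1, -1}"
  shows "(J \<circ> phi) (proj (section_vec a b j)) = (1 / a, - b, j)"
proof -
  have b: "b < 1" using assms sqrt3_bounds by linarith
  note ends = section_ends[OF assms(1) b assms(4)]
  have X: "section_vec a b j \<in> X" using assms mem_X_iff by blast
  have "geodesic_of (section_vec a b j) \<in> geodesics"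
    unfolding geodesics_def using section_vec_T1H[OF assms(1) b assms(4)] by blast
  then have "geodesic_of (section_vec a b j) \<in> A_plus \<longleftrightarrow> j = 1"
    using assms by (auto simp: A_plus_def ends I_plus_def)
  then show ?thesis
    unfolding comp_apply phi_proj[OF X] J_def ends using assms(4) by auto
qed

lemma mem_X_star_iff:
  assumes "a > 1" "- sqrt 3 \<le> b" "b < 2 - sqrt 3" "j \<in> {1, -1}"
  shows "section_vec a b j \<in> X_star \<longleftrightarrow> a \<notin> exceptional"
proof -
  have b: "b < 1" using assms sqrt3_bounds by linarith
  have "section_vec a b j \<in> X" using assms mem_X_iff by blast
  moreover have "\<bar>real_of_int j * a\<bar> = a" using assms by auto
  ultimately show ?thesis by (simp add: X_star_def section_ends(1)[OF assms(1) b assms(4)])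
qed

lemma J_phi_bij: "bij_betw (J \<circ> phi) (proj ` X) Omega"
  unfolding bij_betw_def
proof
  show "inj_on (J \<circ> phi) (proj ` X)"
  proof (rule inj_onI)
    fix u u' assume "u \<in> proj ` X" "u' \<in> proj ` X" and eq: "(J \<circ> phi) u = (J \<circ> phi) u'"
    then obtain a b j a' b' j' where
      "a > 1" "- sqrt 3 \<le> b" "b < 2 - sqrt 3" "j \<in> {1, -1}" "u = proj (section_vec a b j)"
      "a' > 1" "- sqrt 3 \<le> b'" "b' < 2 - sqrt 3" "j' \<in> {1, -1}" "u' = proj (section_vec a' b' j')"
      unfolding image_iff Bex_def mem_X_iff by blast
    moreover from this eq have "(1 / a, - b, j) = (1 / a', - b', j')" by (simp only: J_section)
    ultimately show "u = u'" by simp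
  qed
  show "(J \<circ> phi) ` (proj ` X) = Omega"
  proof
    show "(J \<circ> phi) ` (proj ` X) \<subseteq> Omega"
    proof
      fix w assume "w \<in> (J \<circ> phi) ` (proj ` X)"
      then obtain a b j where ab: "a > 1" "- sqrt 3 \<le> b" "b < 2 - sqrt 3" "j \<in> {1, -1}"
        and w: "w = (J \<circ> phi) (proj (section_vec a b j))"
        unfolding image_iff Bex_def mem_X_iff by blast
      show "w \<in> Omega" unfolding w J_section[OF ab] Omega_def using ab by auto
    qed
    show "Omega \<subseteq> (J \<circ> phi) ` (proj ` X)"
    proof
      fix w assume "w \<in> Omega"
      then obtain x y j where w: "w = (x, y, j)" "0 < x" "x < 1" "sqrt 3 - 2 < y" "y \<le> sqrt 3" "j \<in> {1, -1}"
        by (cases w) (auto simp: Omega_def)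
      then have *: "1 / x > 1" "- sqrt 3 \<le> - y" "- y < 2 - sqrt 3" "j \<in> {1, -1}" by auto
      then have "section_vec (1 / x) (- y) j \<in> X" using mem_X_iff by blast
      moreover have "w = (J \<circ> phi) (proj (section_vec (1 / x) (- y) j))"
        unfolding J_section[OF *] using w by simp
      ultimately show "w \<in> (J \<circ> phi) ` (proj ` X)" by blast
    qed
  qed
qed

lemma Omega_star_iff:
  "(x, y, j) \<in> Omega_star \<longleftrightarrow> (x, y, j) \<in> Omega \<and> 1 / x \<notin> exceptional"
proof -
  have "(\<exists>e\<in>exceptional. x = 1 / e) \<longleftrightarrow> 1 / x \<in> exceptional" for x :: real
  proof
    assume "1 / x \<in> exceptional"
    then show "\<exists>e\<in>exceptional. x = 1 / e" by (intro bexI[of _ "1 / x"]) simp_all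
  qed auto
  then have "(\<forall>\<sigma>\<in>alphabet. x \<notin> frontier (cell \<sigma>)) \<longleftrightarrow> 1 / x \<notin> exceptional"
    using frontier_cell_iff[of x] by blast
  then show ?thesis by (simp add: Omega_star_def)
qed

lemma J_phi_star: "(J \<circ> phi) ` (proj ` X_star) = Omega_star"
proof
  show "(J \<circ> phi) ` (proj ` X_star) \<subseteq> Omega_star"
  proof
    fix w assume "w \<in> (J \<circ> phi) ` (proj ` X_star)"
    then obtain v where v: "v \<in> X_star" "w = (J \<circ> phi) (proj v)" by blast
    then have "v \<in> X" by (simp add: X_star_def)
    then obtain a b j where ab: "a > 1" "- sqrt 3 \<le> b" "b < 2 - sqrt 3" "j \<in> {1, -1}"
      and v': "v = section_vec a b j" unfolding mem_X_iff by blast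
    then have "w = (1 / a, - b, j)" using v J_section by blast
    moreover have "w \<in> Omega" using J_phi_bij v(2) \<open>v \<in> X\<close> by (auto simp: bij_betw_def)
    ultimately show "w \<in> Omega_star"
      using mem_X_star_iff[OF ab] v(1) v' by (simp add: Omega_star_iff)
  qed
  show "Omega_star \<subseteq> (J \<circ> phi) ` (proj ` X_star)"
  proof
    fix w assume w: "w \<in> Omega_star"
    then have "w \<in> Omega" by (auto simp: Omega_star_def)
    then have "w \<in> (J \<circ> phi) ` proj ` X" using J_phi_bij by (auto simp: bij_betw_def)
    then obtain v where v: "v \<in> X" "w = (J \<circ> phi) (proj v)" by blast
    then obtain a b j where ab: "a > 1" "- sqrt 3 \<le> b" "b < 2 - sqrt 3" "j \<in> {1, -1}"
      and v': "v = section_vec a b j" unfolding mem_X_iff by blast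
    then have "w = (1 / a, - b, j)" using v J_section by blast
    then have "v \<in> X_star" using mem_X_star_iff[OF ab] w v' by (simp add: Omega_star_iff)
    then show "w \<in> (J \<circ> phi) ` (proj ` X_star)" using v(2) by blast
  qed
qed

lemma double_cover_symbol:
  assumes "first_symbol x = (k, \<epsilon>, s)"
  shows "double_cover (x, y, j) = (branch (k, \<epsilon>, s) x, hbar (k, \<epsilon>, s) y, - \<epsilon> * j)"
  by (simp only: double_cover_def natural_extension_def spliced_map_def assms prod.case)

section \<open>The first return as a sequence of moves\<close>

lemma first_return_even:
  assumes ab: "b < 2 - sqrt 3" "j \<in> {1, -1}" and k: "k \<ge> 1"
  shows "2 * real k < a \<Longrightarrow> a < 2 * real k + 1 \<Longrightarrow>
      first_hit (proj (section_vec a b j)) (proj (section_vec (1 / (a - 2 * real k)) (1 / (b - 2 * real k)) (- j)))"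
    and "2 * real k - 1 < a \<Longrightarrow> a < 2 * real k \<Longrightarrow>
      first_hit (proj (section_vec a b j)) (proj (section_vec (1 / (2 * real k - a)) (1 / (2 * real k - b)) j))"
proof -
  \<comment> \<open>Only \<open>n = k - 1\<close> plain translations occur; the last one is built
    into the inverting move.\<close>
  obtain n where n: "k = Suc n" using k by (cases k) auto
  let ?a = "a - 2 * real n" and ?b = "b - 2 * real n"
  have b: "?b < 1" using ab(1) sqrt3_bounds by (simp, linarith)
  have e: "a - 2 * real k = ?a - 2" "b - 2 * real k = ?b - 2"
    "2 * real k - a = 2 - ?a" "2 * real k - b = 2 - ?b" by (simp_all add: n)
  show "first_hit (proj (section_vec a b j)) (proj (section_vec (1 / (a - 2 * real k)) (1 / (b - 2 * real k)) (- j)))"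
    if "2 * real k < a" "a < 2 * real k + 1"
    unfolding e
  proof (rule first_hit_translates)
    have "2 < ?a" "?a < 3" using that n by simp_all
    then show "first_hit (proj (section_vec ?a ?b j)) (proj (section_vec (1 / (?a - 2)) (1 / (?b - 2)) (- j)))"
      using b ab(2) by (rule step_invert_opposite)
    show "2 * real n + 1 < a" using that n by simp
  qed (rule ab)+
  show "first_hit (proj (section_vec a b j)) (proj (section_vec (1 / (2 * real k - a)) (1 / (2 * real k - b)) j))"
    if "2 * real k - 1 < a" "a < 2 * real k"
    unfolding e
  proof (rule first_hit_translates)
    have "1 < ?a" "?a < 2" using that n by simp_all
    then show "first_hit (proj (section_vec ?a ?b j)) (proj (section_vec (1 / (2 - ?a)) (1 / (2 - ?b)) j))"
      using b ab(2) by (rule step_invert_same)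
    show "2 * real n + 1 < a" using that n by simp
  qed (rule ab)+
qed

text \<open>After \<open>n\<close> moves \<open>a \<mapsto> 1/(2 - a)\<close> the coordinate is
  \<open>s - n\<close> in (0, 1). Below 1/2 it means \<open>a' > 3\<close>, and the run ends with a
  translation; above 1/2 it means \<open>2 < a' < 3\<close>, and the run ends with the inversion
  that changes the sign.\<close>

lemma first_return_odd:
  fixes s q :: real
  assumes "q < 0" "- sqrt 3 \<le> 1 + 1 / q" "j \<in> {1, -1}"
    and a': "a' = 1 + 1 / (s - real n)" and b': "b' = 1 + 1 / (q - real n)"
  shows "real n + 1 / 2 < s \<Longrightarrow> s < real n + 1 \<Longrightarrow>
      first_hit (proj (section_vec (1 + 1 / s) (1 + 1 / q) j)) (proj (section_vec (1 / (a' - 2)) (1 / (b' - 2)) (- j)))"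
    and "real n < s \<Longrightarrow> s < real n + 1 / 2 \<Longrightarrow>
      first_hit (proj (section_vec (1 + 1 / s) (1 + 1 / q) j)) (proj (section_vec (a' - 2) (b' - 2) j))"
proof -
  have b1: "b' < 1" using assms(1) by (simp add: b')
  show "first_hit (proj (section_vec (1 + 1 / s) (1 + 1 / q) j)) (proj (section_vec (1 / (a' - 2)) (1 / (b' - 2)) (- j)))"
    if "real n + 1 / 2 < s" "s < real n + 1"
  proof (rule first_hit_inversions[where n = n])
    have "2 < a'" "a' < 3" unfolding a' using that by (simp_all add: field_simps)
    then show "first_hit (proj (section_vec (1 + 1 / (s - real n)) (1 + 1 / (q - real n)) j))
       (proj (section_vec (1 / (a' - 2)) (1 / (b' - 2)) (- j)))"
      unfolding a'[symmetric] b'[symmetric] using b1 assms(3) by (rule step_invert_opposite)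
  qed (use that assms in auto)
  show "first_hit (proj (section_vec (1 + 1 / s) (1 + 1 / q) j)) (proj (section_vec (a' - 2) (b' - 2) j))"
    if "real n < s" "s < real n + 1 / 2"
  proof (rule first_hit_inversions[where n = n])
    have "3 < a'" unfolding a' using that by (simp add: field_simps)
    then show "first_hit (proj (section_vec (1 + 1 / (s - real n)) (1 + 1 / (q - real n)) j))
       (proj (section_vec (a' - 2) (b' - 2) j))"
      unfolding a'[symmetric] b'[symmetric] using b1 assms(3) by (rule step_translate)
  qed (use that assms in auto)
qed

lemma first_return_section:
  assumes ab: "a > 1" "- sqrt 3 \<le> b" "b < 2 - sqrt 3" "j \<in> {1, -1}" and "a \<notin> exceptional"
  obtains a' b' j' where "a' > 1" "- sqrt 3 \<le> b'" "b' < 2 - sqrt 3" "j' \<in> {1, -1}"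
    "first_hit (proj (section_vec a b j)) (proj (section_vec a' b' j'))"
    "(1 / a', - b', j') = double_cover (1 / a, - b, j)"
  using ab(1) assms(5)
proof (cases rule: symbol_cases)
  case (even_pos k)
  have al: "(k, 1, Ev) \<in> alphabet" using even_pos(1) by (cases "k = 1") (auto simp: alphabet_def)
  have fs: "first_symbol (1 / a) = (k, 1, Ev)" using even_pos by (intro first_symbol_Ev[OF al]) auto
  have k: "real k \<ge> 1" using even_pos(1) by simp
  have bk: "b - 2 * real k < - sqrt 3" using ab(3) k by linarith
  then have bk': "b - 2 * real k < -1" using sqrt3_bounds by linarith
  show ?thesis
  proof (rule that)
    show "1 / (a - 2 * real k) > 1" using even_pos by simp
    have "1 / (b - 2 * real k) > -1" "1 / (b - 2 * real k) < 0" using bk' by (simp_all add: field_simps)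
    then show "- sqrt 3 \<le> 1 / (b - 2 * real k)" "1 / (b - 2 * real k) < 2 - sqrt 3"
      using sqrt3_bounds by linarith+
    show "- j \<in> {1, -1}" using ab(4) by auto
    show "first_hit (proj (section_vec a b j)) (proj (section_vec (1 / (a - 2 * real k)) (1 / (b - 2 * real k)) (- j)))"
      using ab(3,4) even_pos by (rule first_return_even)
    show "(1 / (1 / (a - 2 * real k)), - (1 / (b - 2 * real k)), - j) = double_cover (1 / a, - b, j)"
      unfolding double_cover_symbol[OF fs] using bk' by (simp add: field_simps)
  qed
next
  case (even_neg k)
  have al: "(k, -1, Ev) \<in> alphabet" using even_neg(1) by (auto simp: alphabet_def)
  have fs: "first_symbol (1 / a) = (k, -1, Ev)" using even_neg by (intro first_symbol_Ev[OF al]) auto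
  have k: "real k \<ge> 2" "k \<ge> 1" using even_neg(1) by simp_all
  \<comment> \<open>Here \<open>k \<ge> 2\<close> matters: for \<open>k = 1\<close> the inversion
    would leave the section and begin an odd run, which is why the alphabet has no symbol
    \<open>(1, -1, Ev)\<close>.\<close>
  have bk: "2 * real k - b > 2 + sqrt 3" using ab(3) k by linarith
  have pos: "2 + sqrt 3 > 0" by (simp add: add_pos_nonneg)
  have bk0: "2 * real k - b > 0" using bk pos by linarith
  have "(2 - sqrt 3) * (2 + sqrt 3) = 1" by (simp add: algebra_simps)
  then have inv: "1 / (2 + sqrt 3) = 2 - sqrt 3" using pos by (simp add: divide_eq_eq)
  show ?thesis
  proof (rule that)
    show "1 / (2 * real k - a) > 1" using even_neg by simp
    have "1 / (2 * real k - b) < 1 / (2 + sqrt 3)" using bk pos bk0 by (intro divide_strict_left_mono) auto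
    then show "1 / (2 * real k - b) < 2 - sqrt 3" unfolding inv .
    have "1 / (2 * real k - b) > 0" using bk0 by simp
    then show "- sqrt 3 \<le> 1 / (2 * real k - b)" using sqrt3_bounds by linarith
    show "j \<in> {1, -1}" by (rule ab(4))
    show "first_hit (proj (section_vec a b j)) (proj (section_vec (1 / (2 * real k - a)) (1 / (2 * real k - b)) j))"
      using ab(3,4) k(2) even_neg(2,3) by (rule first_return_even)
    show "(1 / (1 / (2 * real k - a)), - (1 / (2 * real k - b)), j) = double_cover (1 / a, - b, j)"
      unfolding double_cover_symbol[OF fs] using bk0 by (simp add: field_simps)
  qed
next
  case (odd_pos k)
  have al: "(k, 1, Od) \<in> alphabet" using odd_pos(1) by (auto simp: alphabet_def)
  have fs: "first_symbol (1 / a) = (k, 1, Od)" using odd_pos ab(1) by (intro first_symbol_Od[OF al]) auto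
  \<comment> \<open>\<open>n\<close> counts the moves \<open>a \<mapsto> 1/(2 - a)\<close>. At least
    one occurs, which puts \<open>b'\<close> into (0, 1).\<close>
  obtain n where n: "k = Suc n" "n \<ge> 1" using odd_pos(1) by (cases k) auto
  define s q where "s = 1 / (a - 1)" and "q = 1 / (b - 1)"
  have b1: "b < 1" using ab(3) sqrt3_bounds by linarith
  have s: "a = 1 + 1 / s" "real n + 1 / 2 < s" "s < real n + 1" and q: "b = 1 + 1 / q" "q < 0"
    using ab(1) b1 odd_pos(2,3) by (simp_all add: s_def q_def n)
  define a' b' where "a' = 1 + 1 / (s - real n)" and "b' = 1 + 1 / (q - real n)"
  have a': "2 < a'" "a' < 3" unfolding a'_def using s by (simp_all add: field_simps)
  have b': "0 < b'" "b' < 1" unfolding b'_def using q n(2) by (simp_all add: field_simps)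
  show ?thesis
  proof (rule that)
    show "1 / (a' - 2) > 1" using a' by simp
    have "1 / (b' - 2) > -1" "1 / (b' - 2) < 0" using b' by (simp_all add: field_simps)
    then show "- sqrt 3 \<le> 1 / (b' - 2)" "1 / (b' - 2) < 2 - sqrt 3" using sqrt3_bounds by linarith+
    show "- j \<in> {1, -1}" using ab(4) by auto
    show "first_hit (proj (section_vec a b j)) (proj (section_vec (1 / (a' - 2)) (1 / (b' - 2)) (- j)))"
      unfolding s(1) q(1) using q(2) ab(2)[unfolded q(1)] ab(4) a'_def b'_def s(2,3)
      by (rule first_return_odd)
    have "s > 0" using s by simp
    then have x: "1 / a = s / (s + 1)" by (subst s(1)) (simp add: field_simps)
    have "branch (k, 1, Od) (1 / a) = a' - 2"
    proof -
      have nz: "s + 1 \<noteq> 0" "s - real n \<noteq> 0" using s by auto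
      have "real k - (real k + 1) * (s / (s + 1)) = (1 - (s - real n)) / (s + 1)"
        "real k * (s / (s + 1)) - (real k - 1) = (s - real n) / (s + 1)"
        using nz by (simp_all add: n field_simps)
      then have "branch (k, 1, Od) (1 / a) = (1 - (s - real n)) / (s - real n)"
        using nz by (simp add: x)
      then show ?thesis using nz(2) by (simp add: a'_def diff_divide_distrib)
    qed
    \<comment> \<open>The term \<open>1/(1 + y)\<close> of \<open>hbar\<close> is \<open>-q\<close>,
      and adding \<open>k - 1 = n\<close> to it is the \<open>n\<close>-fold step
      \<open>q \<mapsto> q - 1\<close>.\<close>
    moreover have "hbar (k, 1, Od) (- b) = - (1 / (b' - 2))"
    proof -
      have "1 / (1 + - b) = - q" using b1 by (simp add: q_def field_simps)
      then have "hbar (k, 1, Od) (- b) = 1 / (1 + 1 / (real n - q))" by (simp add: n)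
      moreover have "b' - 2 = - (1 + 1 / (real n - q))"
        using q(2) by (simp add: b'_def field_simps)
      ultimately show ?thesis by (simp only: divide_minus_right minus_minus)
    qed
    ultimately show "(1 / (1 / (a' - 2)), - (1 / (b' - 2)), - j) = double_cover (1 / a, - b, j)"
      unfolding double_cover_symbol[OF fs] by simp
  qed
next
  case (odd_neg k)
  have al: "(k, -1, Od) \<in> alphabet" using odd_neg(1) by (auto simp: alphabet_def)
  have fs: "first_symbol (1 / a) = (k, -1, Od)" using odd_neg ab(1) by (intro first_symbol_Od[OF al]) auto
  obtain n where n: "k = Suc n" "n \<ge> 1" using odd_neg(1) by (cases k) auto
  define s q where "s = 1 / (a - 1)" and "q = 1 / (b - 1)"
  have b1: "b < 1" using ab(3) sqrt3_bounds by linarith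
  have s: "a = 1 + 1 / s" "real n < s" "s < real n + 1 / 2" and q: "b = 1 + 1 / q" "q < 0"
    using ab(1) b1 odd_neg(2,3) by (simp_all add: s_def q_def n)
  define a' b' where "a' = 1 + 1 / (s - real n)" and "b' = 1 + 1 / (q - real n)"
  have a': "3 < a'" unfolding a'_def using s by (simp add: field_simps)
  have b'1: "b' < 1" unfolding b'_def using q n(2) by simp
  \<comment> \<open>The first move already pushes the backward coordinate up to
    \<open>2 - sqrt 3\<close> and later ones only increase it. This is exactly what brings
    \<open>b' - 2\<close> back into the section.\<close>
  have "1 / (q - 1) \<le> 1 / (q - real n)" using q(2) n(2) by (intro divide_left_mono mult_neg_neg) auto
  then have b'2: "2 - sqrt 3 \<le> b'"
    using inversion_step_bound[OF q(2)] ab(2) unfolding q(1) b'_def by linarith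
  show ?thesis
  proof (rule that)
    show "a' - 2 > 1" using a' by simp
    show "- sqrt 3 \<le> b' - 2" "b' - 2 < 2 - sqrt 3" using b'1 b'2 sqrt3_bounds by linarith+
    show "j \<in> {1, -1}" by (rule ab(4))
    show "first_hit (proj (section_vec a b j)) (proj (section_vec (a' - 2) (b' - 2) j))"
      unfolding s(1) q(1) using q(2) ab(2)[unfolded q(1)] ab(4) a'_def b'_def s(2,3)
      by (rule first_return_odd)
    have "s > 0" using s by simp
    then have x: "1 / a = s / (s + 1)" by (subst s(1)) (simp add: field_simps)
    have "branch (k, -1, Od) (1 / a) = 1 / (a' - 2)"
    proof -
      have nz: "s + 1 \<noteq> 0" "s - real n \<noteq> 0" using s by auto
      have "real k - (real k + 1) * (s / (s + 1)) = (1 - (s - real n)) / (s + 1)"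
        "real k * (s / (s + 1)) - (real k - 1) = (s - real n) / (s + 1)"
        using nz by (simp_all add: n field_simps)
      then have "branch (k, -1, Od) (1 / a) = (s - real n) / (1 - (s - real n))"
        using nz by (simp add: x)
      moreover have "a' - 2 = (1 - (s - real n)) / (s - real n)"
        using nz(2) by (simp add: a'_def diff_divide_distrib)
      ultimately show ?thesis by simp
    qed
    \<comment> \<open>For the negative sign the summand in \<open>hbar\<close> is
      \<open>k = n + 1\<close>. The shift is absorbed by \<open>1 + 1/x = 1/(1 - 1/(x + 1))\<close>
      with \<open>x = n - q\<close>.\<close>
    moreover have "hbar (k, -1, Od) (- b) = - (b' - 2)"
    proof -
      have "1 / (1 + - b) = - q" using b1 by (simp add: q_def field_simps)
      then have "hbar (k, -1, Od) (- b) = 1 / (1 - 1 / (real n + 1 - q))" by (simp add: n add_ac)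
      moreover have "1 / (1 - 1 / (real n + 1 - q)) = - (b' - 2)"
        using q(2) by (simp add: b'_def field_simps)
      ultimately show ?thesis by simp
    qed
    ultimately show "(1 / (a' - 2), - (b' - 2), j) = double_cover (1 / a, - b, j)"
      unfolding double_cover_symbol[OF fs] by simp
  qed
qed

text \<open>Of two distinct first return times the smaller would contradict the minimality of the
  larger, so the description in \<open>Phi\<close> is definite.\<close>

lemma first_hit_return:
  assumes "first_hit u u'" "u' \<in> proj ` X"
  shows "\<exists>t. is_first_return_time quotient_flow (proj ` X) u t" and "Phi u = u'"
proof -
  obtain t where t: "t > 0" "quotient_flow t u = u'"
      "\<And>s. 0 < s \<Longrightarrow> s < t \<Longrightarrow> quotient_flow s u \<notin> proj ` X"
    using assms(1) by (auto simp: first_hit_def)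
  then have ret: "is_first_return_time quotient_flow (proj ` X) u t"
    using assms(2) by (simp add: is_first_return_time_def)
  then show "\<exists>t. is_first_return_time quotient_flow (proj ` X) u t" ..
  have "(THE t. is_first_return_time quotient_flow (proj ` X) u t) = t"
  proof (rule the_equality, rule ret)
    fix t' assume "is_first_return_time quotient_flow (proj ` X) u t'"
    then show "t' = t" using ret unfolding is_first_return_time_def by (metis linorder_neqE)
  qed
  then show "Phi u = u'" by (simp add: Phi_def first_return_map_def t(2))
qed

theorem theorem3p7:
  shows "(\<forall>v\<in>X. phi (proj v) = geodesic_of v) \<and>
    bij_betw (J \<circ> phi) (proj ` X) Omega \<and>
    (J \<circ> phi) ` (proj ` X_star) = Omega_star \<and>
    (\<forall>u\<in>proj ` X_star. \<exists>t. is_first_return_time quotient_flow (proj ` X) u t) \<and>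
    (\<forall>u\<in>proj ` X_star. ((J \<circ> phi) \<circ> Phi) u = (double_cover \<circ> (J \<circ> phi)) u)"
proof -
  have "(\<exists>t. is_first_return_time quotient_flow (proj ` X) u t) \<and>
      ((J \<circ> phi) \<circ> Phi) u = (double_cover \<circ> (J \<circ> phi)) u" if u: "u \<in> proj ` X_star" for u
  proof -
    obtain v where v: "v \<in> X_star" "u = proj v" using u by blast
    then have "v \<in> X" by (simp add: X_star_def)
    then obtain a b j where ab: "a > 1" "- sqrt 3 \<le> b" "b < 2 - sqrt 3" "j \<in> {1, -1}"
      and v': "v = section_vec a b j" unfolding mem_X_iff by blast
    have "a \<notin> exceptional" using mem_X_star_iff[OF ab] v(1) v' by simp
    then obtain a' b' j' where ab': "a' > 1" "- sqrt 3 \<le> b'" "b' < 2 - sqrt 3" "j' \<in> {1, -1}"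
      and hit: "first_hit u (proj (section_vec a' b' j'))"
      and eq: "(1 / a', - b', j') = double_cover (1 / a, - b, j)"
      using first_return_section[OF ab] unfolding v(2) v' by metis
    have "section_vec a' b' j' \<in> X" using ab' mem_X_iff by blast
    then have "proj (section_vec a' b' j') \<in> proj ` X" by blast
    note ret = first_hit_return[OF hit this]
    have "(J \<circ> phi) (Phi u) = (1 / a', - b', j')" by (simp only: ret(2) J_section[OF ab'])
    moreover have "(J \<circ> phi) u = (1 / a, - b, j)" by (simp only: v(2) v' J_section[OF ab])
    ultimately have "(J \<circ> phi) (Phi u) = double_cover ((J \<circ> phi) u)" by (simp only: eq)
    then show ?thesis using ret(1) by simp
  qed
  then show ?thesis using phi_proj J_phi_bij J_phi_star by blast
qed

end
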